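(* Let $t\ge -1$ and $n>0$ be integers and suppose that $\operatorname{rank} E_n(\mathbb{Q})=0$. There exists a point in $E_n(K_t)$ with abscissa ($x$-coordinate) $\theta_t-1$ if and only if there is a positive integer $v$ such that $$v^2=2n^2-9,\qquad t=(n+v)^2+3\quad\text{or}\quad t=(n-v)^2+3.$$ At $t=(n+v)^2+3$, the ordinates ($y$-coordinates) of the points of $E_n(K_t)$ with abscissa $\theta_t-1$ are exactly $\pm((n+v)\theta_t+n)$; at $t=(n-v)^2+3$, they are exactly $\pm((n-v)\theta_t+n)$. Every such point $P$ has $\operatorname{Tr}(P)=O$ and infinite order, and its conjugates $P,\sigma P,\sigma^2P$ generate a subgroup of $E_n(K_t)$ of rank two.
   Context: For an integer $t\ge -1$, let $g_t(X)=X^3-tX^2-(t+3)X-1$, let $\theta_t$ be the largest real root of $g_t$, and let $K_t=\mathbb{Q}(\theta_t)$. The polynomial $g_t$ is irreducible over $\mathbb{Q}$ with three real roots, and $K_t/\mathbb{Q}$ is a cyclic cubic extension; let $\sigma$ be the generator of $\operatorname{Gal}(K_t/\mathbb{Q})$ with $\sigma(\theta_t)=-1/(\theta_t+1)$. For a positive integer $n$, $E_n$ is the elliptic curve $y^2=x^3-n^2x$ over $\mathbb{Q}$, with identity element $O$. For $P\in E_n(K_t)$, the trace is $\operatorname{Tr}(P)=P+\sigma P+\sigma^2P\in E_n(\mathbb{Q})$ (sum in the group law of $E_n$). *)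

theory Defs
  imports "HOL-Algebra.Elementary_Groups" "HOL-Algebra.Generated_Fields"
    "HOL-Algebra.Algebraic_Closure_Type" "HOL-Computational_Algebra.Polynomial" "HOL-Library.Extended_Nat"
begin

text \<open>
  The rank of an abelian group (its torsion-free rank, the dimension of its tensor product with
  the rationals) is the largest size of a finite subset that is independent over the integers;
  it is infinite if there is no largest size.
\<close>

definition int_independent :: "('a, 'b) monoid_scheme \<Rightarrow> 'a set \<Rightarrow> bool" where
  "int_independent G S \<longleftrightarrow>
     finite S \<and> S \<subseteq> carrier G \<and>
     (\<forall>c :: 'a \<Rightarrow> int. (\<Otimes>\<^bsub>G\<^esub>s\<in>S. s [^]\<^bsub>G\<^esub> c s) = \<one>\<^bsub>G\<^esub> \<longrightarrow> (\<forall>s\<in>S. c s = 0))"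

definition abelian_rank :: "('a, 'b) monoid_scheme \<Rightarrow> enat" where
  "abelian_rank G = (SUP S\<in>{S. int_independent G S}. enat (card S))"

definition infinite_order :: "('a, 'b) monoid_scheme \<Rightarrow> 'a \<Rightarrow> bool" where
  "infinite_order G x \<longleftrightarrow> (\<forall>m :: nat. m > 0 \<longrightarrow> x [^]\<^bsub>G\<^esub> m \<noteq> \<one>\<^bsub>G\<^esub>)"

text \<open>
  Automorphisms of a subfield \<open>L\<close> that fix \<open>k\<close> pointwise. They are taken to be extensional, so that
  each of them is represented by exactly one function on the whole type.
\<close>

definition Gal :: "'a::field set \<Rightarrow> 'a set \<Rightarrow> ('a \<Rightarrow> 'a) set" where
  "Gal L k = {s \<in> ring_iso (ring_of_type_algebra\<lparr>carrier := L\<rparr>) (ring_of_type_algebra\<lparr>carrier := L\<rparr>).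
                s \<in> extensional L \<and> (\<forall>x\<in>k. s x = x)}"

datatype 'a ec_point = Infinity | Affine 'a 'a

text \<open>
  Chord-and-tangent addition on \<open>y\<^sup>2 = x\<^sup>3 + a * x + b\<close>; the formulas do not involve \<open>b\<close>.
\<close>

fun ec_add :: "'a::field \<Rightarrow> 'a ec_point \<Rightarrow> 'a ec_point \<Rightarrow> 'a ec_point" where
  "ec_add a Infinity Q = Q"
| "ec_add a (Affine x1 y1) Infinity = Affine x1 y1"
| "ec_add a (Affine x1 y1) (Affine x2 y2) =
     (if x1 = x2 \<and> y1 = - y2 then Infinity
      else let l = (if x1 = x2 then (3 * x1^2 + a) / (2 * y1) else (y2 - y1) / (x2 - x1));
               x3 = l^2 - x1 - x2
           in Affine x3 (l * (x1 - x3) - y1))"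

text \<open>The group of points of \<open>y\<^sup>2 = x\<^sup>3 + a * x + b\<close> with coordinates in the subfield \<open>F\<close>.\<close>

definition ec_group :: "'a::field \<Rightarrow> 'a \<Rightarrow> 'a set \<Rightarrow> 'a ec_point monoid" where
  "ec_group a b F =
     \<lparr>carrier = insert Infinity {Affine x y | x y. x \<in> F \<and> y \<in> F \<and> y^2 = x^3 + a * x + b},
      monoid.mult = ec_add a, one = Infinity\<rparr>"

definition E :: "int \<Rightarrow> real set \<Rightarrow> real ec_point monoid" where
  "E n F = ec_group (- (of_int n ^ 2)) 0 F"

definition g :: "int \<Rightarrow> real poly" where
  "g t = [:- 1, - (of_int t + 3), - of_int t, 1:]"

definition theta :: "int \<Rightarrow> real" where
  "theta t = Max {x. poly (g t) x = 0}"

definition K :: "int \<Rightarrow> real set" where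
  "K t = generate_field ring_of_type_algebra {theta t}"

definition sigma :: "int \<Rightarrow> real \<Rightarrow> real" where
  "sigma t = (THE s. s \<in> Gal (K t) \<rat> \<and> s (theta t) = - 1 / (theta t + 1))"

text \<open>The Galois action on points is coordinatewise, that is, by the map function of the datatype.\<close>

abbreviation conj_point :: "int \<Rightarrow> real ec_point \<Rightarrow> real ec_point" where
  "conj_point t \<equiv> map_ec_point (sigma t)"

definition Tr :: "int \<Rightarrow> int \<Rightarrow> real ec_point \<Rightarrow> real ec_point" where
  "Tr n t P = P \<otimes>\<^bsub>E n (K t)\<^esub> conj_point t P \<otimes>\<^bsub>E n (K t)\<^esub> conj_point t (conj_point t P)"

end

theory Submission
  imports Defs
begin

text \<open>
  Let \<open>x = \<theta> - 1\<close> and let \<open>P = (x, y)\<close> be a point of \<open>E n\<close> over \<open>K t\<close>. Its trace \<open>T\<close> is fixed by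
  conjugation, hence a rational point, and a torsion point since the rank over \<open>\<rat>\<close> is zero. The
  prime 2 is inert in \<open>K t\<close>, and duplication strictly lowers the 2-adic valuation of an abscissa once
  this valuation is below that of \<open>n\<close>, which it is after one duplication. So every point over
  \<open>K t\<close> with nonzero ordinate has infinite order (\<open>infinite_order_E\<close>), and \<open>T\<close> is either zero or
  one of the three points \<open>(e, 0)\<close>.

  A point of trace zero with irrational abscissa lies with its two conjugates on a line over \<open>\<rat>\<close>
  (\<open>trace_zero_line\<close>). If \<open>T = (e, 0)\<close>, then \<open>P + T\<close> has trace \<open>4 T = 0\<close>, and the line through
  its conjugates makes the norm of \<open>x(P + T) - e\<close> a square; for \<open>e = 0\<close> the sign and for
  \<open>e = n\<close>, \<open>e = - n\<close> the parity of the norm of \<open>x - e\<close> excludes this (\<open>trace_zero\<close>). So \<open>T\<close> is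
  zero. Comparing \<open>X\<^sup>3 - n\<^sup>2 X - (a X + b)\<^sup>2\<close> with the minimal polynomial of \<open>x\<close> gives
  \<open>a\<^sup>2 = t - 3\<close>, \<open>b\<^sup>2 = 2 t + 3\<close>, \<open>2 a b = 3 t - n\<^sup>2\<close>, whence
  \<open>(t - 3 n\<^sup>2 + 6)\<^sup>2 = (2 n)\<^sup>2 (2 n\<^sup>2 - 9)\<close>, which is the condition on \<open>t\<close>
  (\<open>parameter_from_trace_zero\<close>). The converse is a direct computation (\<open>ordinates\<close>).

  A nontrivial relation between \<open>P\<close> and its conjugate would, together with the conjugate relation,
  bound the order of \<open>P\<close>; as \<open>P\<close> has infinite order, the conjugates generate a group of rank two
  (\<open>trace_zero_rank_two\<close>).

  All of this rests on \<open>E n\<close> being an abelian group. Associativity is proved in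
  \<open>ec_add_assoc\<close> by determining both triple sums from the slopes of the two inner lines.
\<close>

section \<open>The chord-and-tangent group law\<close>

text \<open>The opposite point, the reflection in the first axis.\<close>

fun ec_neg :: "'a::field ec_point \<Rightarrow> 'a ec_point" where
  "ec_neg Infinity = Infinity"
| "ec_neg (Affine x y) = Affine x (- y)"

text \<open>
  The points of \<open>y\<^sup>2 = x\<^sup>3 + a * x + b\<close> with coordinates anywhere in the type.
\<close>

fun on_curve :: "'a::field \<Rightarrow> 'a \<Rightarrow> 'a ec_point \<Rightarrow> bool" where
  "on_curve a b Infinity \<longleftrightarrow> True"
| "on_curve a b (Affine x y) \<longleftrightarrow> y^2 = x^3 + a * x + b"

text \<open>
  The slope of the line through two points that are not opposite. The first equation determines
  it when the abscissas differ, the second one when the ordinates are not opposite; on the curve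
  the two equations are compatible, so chords and tangents need no separate treatment.
\<close>

definition is_slope :: "'a::field \<Rightarrow> 'a \<Rightarrow> 'a \<Rightarrow> 'a \<Rightarrow> 'a \<Rightarrow> 'a \<Rightarrow> bool" where
  "is_slope a x1 y1 x2 y2 l \<longleftrightarrow>
     l * (x2 - x1) = y2 - y1 \<and> l * (y1 + y2) = x1^2 + x1 * x2 + x2^2 + a"

lemma is_slope_sym: "is_slope a x1 y1 x2 y2 l \<Longrightarrow> is_slope a x2 y2 x1 y1 l"
  unfolding is_slope_def by Groebner_Basis.algebra

lemma ec_add_affine:
  fixes a :: "'a::field_char_0"
  assumes c1: "y1^2 = x1^3 + a * x1 + b" and c2: "y2^2 = x2^3 + a * x2 + b"
    and ne: "\<not> (x1 = x2 \<and> y1 = - y2)"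
  obtains l where "is_slope a x1 y1 x2 y2 l"
    "ec_add a (Affine x1 y1) (Affine x2 y2) = Affine (l^2 - x1 - x2) (l * (x1 - (l^2 - x1 - x2)) - y1)"
proof -
  define l where "l = (if x1 = x2 then (3 * x1^2 + a) / (2 * y1) else (y2 - y1) / (x2 - x1))"
  have "is_slope a x1 y1 x2 y2 l"
  proof (cases "x1 = x2")
    case True
    with c1 c2 have "(y1 - y2) * (y1 + y2) = 0" by Groebner_Basis.algebra
    with ne True have "y2 = y1" by (auto simp: add_eq_0_iff)
    moreover from this ne True have "y1 \<noteq> 0" by auto
    ultimately show ?thesis
      using True by (simp add: is_slope_def l_def field_simps power2_eq_square)
  next
    case False
    then have *: "l * (x2 - x1) = y2 - y1" by (simp add: l_def)
    have "(x2 - x1) * (l * (y1 + y2)) = (x2 - x1) * (x1^2 + x1 * x2 + x2^2 + a)"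
      using * c1 c2 by Groebner_Basis.algebra
    with False * show ?thesis by (simp add: is_slope_def)
  qed
  moreover have "ec_add a (Affine x1 y1) (Affine x2 y2)
      = Affine (l^2 - x1 - x2) (l * (x1 - (l^2 - x1 - x2)) - y1)"
    using ne by (simp add: l_def Let_def)
  ultimately show thesis using that by blast
qed

lemma is_slope_unique:
  fixes a :: "'a::field"
  assumes "is_slope a x1 y1 x2 y2 l" "is_slope a x1 y1 x2 y2 k" "\<not> (x1 = x2 \<and> y1 = - y2)"
  shows "l = k"
proof (cases "x1 = x2")
  case True
  with assms(3) have "y1 + y2 \<noteq> 0" by (auto simp: add_eq_0_iff2)
  then show ?thesis using assms(1,2) unfolding is_slope_def by (metis mult_cancel_right)
next
  case False
  then have "x2 - x1 \<noteq> 0" by simp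
  then show ?thesis using assms(1,2) unfolding is_slope_def by (metis mult_cancel_right)
qed

lemma ec_add_slope:
  fixes a :: "'a::field_char_0"
  assumes "y1^2 = x1^3 + a * x1 + b" "y2^2 = x2^3 + a * x2 + b"
    and "\<not> (x1 = x2 \<and> y1 = - y2)" and "is_slope a x1 y1 x2 y2 l"
  shows "ec_add a (Affine x1 y1) (Affine x2 y2)
    = Affine (l^2 - x1 - x2) (l * (x1 - (l^2 - x1 - x2)) - y1)"
  using ec_add_affine[OF assms(1-3)] is_slope_unique[OF _ assms(4,3)] by metis

lemma ec_add_Infinity_right [simp]: "ec_add a P Infinity = P"
  by (cases P) auto

lemma ec_neg_neg [simp]: "ec_neg (ec_neg P) = P"
  by (cases P) auto

lemma on_curve_neg [simp]: "on_curve a b (ec_neg P) \<longleftrightarrow> on_curve a b P"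
  by (cases P) auto

lemma ec_add_neg_left [simp]: "ec_add a (ec_neg P) P = Infinity"
  by (cases P) auto

lemma ec_add_eq_Infinity_iff: "ec_add a P Q = Infinity \<longleftrightarrow> Q = ec_neg P"
  by (cases P; cases Q) (auto simp: Let_def)

lemma ec_add_opposite [simp]: "ec_add a (Affine x y) (Affine x (- y)) = Infinity"
  "ec_add a (Affine x (- y)) (Affine x y) = Infinity"
  by simp_all

text \<open>From here on, sums of affine points are computed from a slope, by \<open>ec_add_slope\<close>.\<close>

declare ec_add.simps(3) [simp del]

lemma ec_add_commute:
  fixes a :: "'a::field_char_0"
  assumes "on_curve a b P" "on_curve a b Q"
  shows "ec_add a P Q = ec_add a Q P"
proof (cases P)
  case [simp]: (Affine x1 y1)
  show ?thesis
  proof (cases Q)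
    case [simp]: (Affine x2 y2)
    show ?thesis
    proof (cases "x1 = x2 \<and> y1 = - y2")
      case False
      with assms obtain l where l: "is_slope a x1 y1 x2 y2 l" by (auto elim: ec_add_affine)
      have "l * (x2 - x1) = y2 - y1" using l by (simp add: is_slope_def)
      then have "l * (x1 - (l^2 - x1 - x2)) - y1 = l * (x2 - (l^2 - x2 - x1)) - y2" by Groebner_Basis.algebra
      moreover have "ec_add a P Q = Affine (l^2 - x1 - x2) (l * (x1 - (l^2 - x1 - x2)) - y1)"
        using assms False l by (simp add: ec_add_slope)
      moreover have "ec_add a Q P = Affine (l^2 - x2 - x1) (l * (x2 - (l^2 - x2 - x1)) - y2)"
        unfolding \<open>P = _\<close> \<open>Q = _\<close>
        by (rule ec_add_slope) (use assms False is_slope_sym[OF l] in auto)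
      ultimately show ?thesis by simp
    qed auto
  qed simp
qed simp

lemma on_curve_add:
  fixes a :: "'a::field_char_0"
  assumes "on_curve a b P" "on_curve a b Q"
  shows "on_curve a b (ec_add a P Q)"
proof (cases P)
  case [simp]: (Affine x1 y1)
  show ?thesis
  proof (cases Q)
    case [simp]: (Affine x2 y2)
    show ?thesis
    proof (cases "x1 = x2 \<and> y1 = - y2")
      case False
      with assms obtain l where l: "is_slope a x1 y1 x2 y2 l"
        and *: "ec_add a P Q = Affine (l^2 - x1 - x2) (l * (x1 - (l^2 - x1 - x2)) - y1)"
        by (auto elim: ec_add_affine)
      have 1: "2 * l * y1 = x1^2 + x1 * x2 + x2^2 + a - l^2 * (x2 - x1)"
        using l unfolding is_slope_def by Groebner_Basis.algebra
      show ?thesis using assms 1 unfolding * by simp Groebner_Basis.algebra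
    qed auto
  qed (use assms in auto)
qed (use assms in auto)

lemma ec_add_neg_neg:
  fixes a :: "'a::field_char_0"
  assumes "on_curve a b P" "on_curve a b Q"
  shows "ec_add a (ec_neg P) (ec_neg Q) = ec_neg (ec_add a P Q)"
proof (cases P)
  case [simp]: (Affine x1 y1)
  show ?thesis
  proof (cases Q)
    case [simp]: (Affine x2 y2)
    show ?thesis
    proof (cases "x1 = x2 \<and> y1 = - y2")
      case False
      with assms obtain l where l: "is_slope a x1 y1 x2 y2 l"
        and *: "ec_add a P Q = Affine (l^2 - x1 - x2) (l * (x1 - (l^2 - x1 - x2)) - y1)"
        by (auto elim: ec_add_affine)
      have "is_slope a x1 (- y1) x2 (- y2) (- l)"
        using l unfolding is_slope_def by Groebner_Basis.algebra
      then have "ec_add a (Affine x1 (- y1)) (Affine x2 (- y2))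
          = Affine ((- l)^2 - x1 - x2) ((- l) * (x1 - ((- l)^2 - x1 - x2)) - (- y1))"
        using assms False by (intro ec_add_slope) auto
      then show ?thesis unfolding * by simp
    qed auto
  qed (use assms in auto)
qed (use assms in auto)

text \<open>
  No point with ordinate zero is singular. As every singular point has ordinate zero, this says that
  the curve has no singular point over the field.
\<close>

definition nonsingular :: "'a::field \<Rightarrow> 'a \<Rightarrow> bool" where
  "nonsingular a b \<longleftrightarrow> (\<forall>x. x^3 + a * x + b = 0 \<longrightarrow> 3 * x^2 + a \<noteq> 0)"

lemma ec_add_neq_right:
  fixes a :: "'a::field_char_0"
  assumes ns: "nonsingular a b" and "on_curve a b P" "on_curve a b Q" "P \<noteq> Infinity"
  shows "ec_add a P Q \<noteq> Q"
proof
  assume eq: "ec_add a P Q = Q"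
  obtain x1 y1 where [simp]: "P = Affine x1 y1" using assms(4) by (cases P) auto
  from eq obtain x2 y2 where [simp]: "Q = Affine x2 y2" by (cases Q) auto
  have ne: "\<not> (x1 = x2 \<and> y1 = - y2)" using eq by auto
  with assms obtain l where l: "is_slope a x1 y1 x2 y2 l"
    and *: "ec_add a P Q = Affine (l^2 - x1 - x2) (l * (x1 - (l^2 - x1 - x2)) - y1)"
    by (auto elim: ec_add_affine)
  have 1: "x2 = l^2 - x1 - x2" and 2: "y2 = l * (x1 - x2) - y1"
    using * unfolding eq by simp_all
  have "2 * y2 = 0" using l 2 unfolding is_slope_def by Groebner_Basis.algebra
  then have y2: "y2 = 0" by simp
  have "3 * x2^2 + a = 0" using l 1 2 unfolding is_slope_def y2 by Groebner_Basis.algebra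
  moreover have "x2^3 + a * x2 + b = 0" using assms(3) y2 by simp
  ultimately show False using ns by (auto simp: nonsingular_def)
qed

text \<open>
  Three points sum to zero if and only if they are the intersection of the curve with a line, which
  is a symmetric condition.
\<close>

lemma ec_add_eq_neg_rotate:
  fixes a :: "'a::field_char_0"
  assumes ns: "nonsingular a b" and on: "on_curve a b P" "on_curve a b Q"
    and eq: "ec_add a P Q = ec_neg R"
  shows "ec_add a Q R = ec_neg P"
proof -
  have onR: "on_curve a b R" using on_curve_add[OF on] eq by (metis on_curve_neg)
  show ?thesis
  proof (cases "P = Infinity \<or> Q = Infinity \<or> R = Infinity")
    case True
    then show ?thesis
    proof (elim disjE)
      assume "R = Infinity"
      then show ?thesis using eq by (simp add: ec_add_eq_Infinity_iff)
    qed (use eq in \<open>auto simp: ec_add_eq_Infinity_iff\<close>)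
  next
    case False
    then obtain x1 y1 x2 y2 x3 y3 where
      [simp]: "P = Affine x1 y1" "Q = Affine x2 y2" "R = Affine x3 y3"
      by (metis ec_point.exhaust)
    have ne: "\<not> (x1 = x2 \<and> y1 = - y2)" using eq by auto
    with on obtain l where l: "is_slope a x1 y1 x2 y2 l"
      and *: "ec_add a P Q = Affine (l^2 - x1 - x2) (l * (x1 - (l^2 - x1 - x2)) - y1)"
      by (auto elim: ec_add_affine)
    have x3: "x3 = l^2 - x1 - x2" and y3: "y3 = y1 - l * (x1 - x3)"
      using * eq by (auto simp: algebra_simps)
    have ne': "\<not> (x2 = x3 \<and> y2 = - y3)"
      using ec_add_neq_right[OF ns on] eq by auto
    have l': "is_slope a x2 y2 x3 y3 l"
      using l x3 y3 unfolding is_slope_def by Groebner_Basis.algebra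
    have "ec_add a Q R = Affine (l^2 - x2 - x3) (l * (x2 - (l^2 - x2 - x3)) - y2)"
      unfolding \<open>Q = _\<close> \<open>R = _\<close> by (rule ec_add_slope) (use on onR ne' l' in auto)
    moreover have "l^2 - x2 - x3 = x1" "l * (x2 - x1) - y2 = - y1"
      using l x3 unfolding is_slope_def by auto
    ultimately show ?thesis by simp
  qed
qed

lemma ec_add_neg_cancel:
  fixes a :: "'a::field_char_0"
  assumes ns: "nonsingular a b" and on: "on_curve a b P" "on_curve a b R"
  shows "ec_add a (ec_neg P) (ec_add a P R) = R"
proof -
  define T where "T = ec_neg (ec_add a P R)"
  have onT: "on_curve a b T" using on_curve_add[OF on] by (simp add: T_def)
  have "ec_add a P R = ec_neg T" by (simp add: T_def)
  then have "ec_add a R T = ec_neg P" by (rule ec_add_eq_neg_rotate[OF ns on])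
  then have "ec_add a T P = ec_neg R" by (rule ec_add_eq_neg_rotate[OF ns on(2) onT])
  then have "ec_add a P T = ec_neg R" using ec_add_commute on(1) onT by metis
  then have "ec_add a (ec_neg P) (ec_neg T) = R" using ec_add_neg_neg[OF on(1) onT] by simp
  then show ?thesis by (simp add: T_def)
qed

text \<open>
  If \<open>l\<close> and \<open>k\<close> are the slopes of the lines through \<open>P, Q\<close> and through \<open>Q, R\<close>, and \<open>m\<close> is the
  slope of the line through \<open>P + Q\<close> and \<open>R\<close>, then \<open>x(R) - x(P) = (k - l) * (l + m)\<close>. With \<open>P\<close> and
  \<open>R\<close> exchanged, the same holds for the slope of the line through \<open>P\<close> and \<open>Q + R\<close>. If \<open>k \<noteq> l\<close>, both
  outer slopes are thus determined by \<open>l\<close> and \<open>k\<close>, and the two triple sums agree.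
\<close>

lemma slope_triple:
  fixes a :: "'a::field"
  assumes l: "is_slope a x1 y1 x2 y2 l" and k: "is_slope a x2 y2 x3 y3 k"
    and x4: "x4 = l^2 - x1 - x2" and y4: "y4 = l * (x1 - x4) - y1"
    and m: "is_slope a x4 y4 x3 y3 m" and ne: "\<not> (x4 = x3 \<and> y4 = - y3)"
  shows "x3 - x1 = (k - l) * (l + m)"
proof (cases "x4 = x3")
  case False
  have "(k - l) * (2 * y2 + (k + l) * (x3 - x2)) = (x3 - x1) * (x3 - x4)"
    using l k x4 unfolding is_slope_def by Groebner_Basis.algebra
  moreover have "(l + m) * (x3 - x4) = 2 * y2 + (k + l) * (x3 - x2)"
    using l k m y4 unfolding is_slope_def by Groebner_Basis.algebra
  ultimately have "(x3 - x1) * (x3 - x4) = (k - l) * (l + m) * (x3 - x4)"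
    by (simp add: mult.assoc)
  then show ?thesis using False by simp
next
  case True
  then have y: "y4 = y3" using m by (simp add: is_slope_def)
  with ne True have "y3 + y3 \<noteq> 0" by (simp add: eq_neg_iff_add_eq_0)
  have 1: "(k - l) * (x3 - x2) = y3 + y3"
    using l k True y y4 unfolding is_slope_def by Groebner_Basis.algebra
  have 2: "(l + m) * (y3 + y3) = (x3 - x1) * (x3 - x2)"
    using l m True y x4 y4 unfolding is_slope_def by Groebner_Basis.algebra
  have "(x3 - x1) * (y3 + y3) = (k - l) * (l + m) * (y3 + y3)"
    using 1 2 by Groebner_Basis.algebra
  then show ?thesis using \<open>y3 + y3 \<noteq> 0\<close> by simp
qed

lemma ec_add_assoc:
  fixes a :: "'a::field_char_0"
  assumes ns: "nonsingular a b" and on: "on_curve a b P" "on_curve a b Q" "on_curve a b R"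
  shows "ec_add a (ec_add a P Q) R = ec_add a P (ec_add a Q R)"
proof -
  have comm: "ec_add a S T = ec_add a T S" if "on_curve a b S" "on_curve a b T" for S T
    using ec_add_commute that .
  note clo = on_curve_add
  \<comment> \<open>In the last, generic case all four additions are of affine points that are not opposite.\<close>
  consider "P = Infinity \<or> Q = Infinity \<or> R = Infinity" | "Q = ec_neg P" | "R = ec_neg Q"
    | "P \<noteq> Infinity" "Q \<noteq> Infinity" "R \<noteq> Infinity" "ec_add a P Q = ec_neg R"
    | "P \<noteq> Infinity" "Q \<noteq> Infinity" "R \<noteq> Infinity" "ec_add a Q R = ec_neg P"
    | "P \<noteq> Infinity" "Q \<noteq> Infinity" "R \<noteq> Infinity" "Q \<noteq> ec_neg P" "R \<noteq> ec_neg Q"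
      "ec_add a P Q \<noteq> ec_neg R" "ec_add a Q R \<noteq> ec_neg P"
    by blast
  then show ?thesis
  proof cases
    case 1
    then show ?thesis by auto
  next
    case 2
    have "ec_add a P (ec_add a Q R) = R"
      using ec_add_neg_cancel[OF ns, of Q R] on 2 by simp
    moreover have "ec_add a P Q = Infinity" using 2 by (simp add: ec_add_eq_Infinity_iff)
    ultimately show ?thesis by simp
  next
    case 3
    have "ec_add a (ec_add a P Q) R = ec_add a (ec_neg Q) (ec_add a Q P)"
      using 3 on comm clo by (metis on_curve_neg)
    also have "\<dots> = P" using ec_add_neg_cancel[OF ns] on by simp
    finally show ?thesis using 3 by (simp add: ec_add_eq_Infinity_iff[THEN iffD2])
  next
    case 4
    then show ?thesis using ec_add_eq_neg_rotate[OF ns on(1,2) 4(4)]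
      by (simp add: ec_add_eq_Infinity_iff[THEN iffD2])
  next
    case 5
    have "ec_add a R P = ec_neg Q" by (rule ec_add_eq_neg_rotate[OF ns on(2,3) 5(4)])
    then have "ec_add a P Q = ec_neg R" by (rule ec_add_eq_neg_rotate[OF ns on(3,1)])
    then show ?thesis using 5(4) by (simp add: ec_add_eq_Infinity_iff[THEN iffD2])
  next
    case 6
    obtain x1 y1 x2 y2 x3 y3 where
      [simp]: "P = Affine x1 y1" "Q = Affine x2 y2" "R = Affine x3 y3"
      using 6(1-3) by (metis ec_point.exhaust)
    note c = on[simplified]
    have n12: "\<not> (x1 = x2 \<and> y1 = - y2)" and n23: "\<not> (x2 = x3 \<and> y2 = - y3)" using 6(4,5) by auto
    obtain l where l: "is_slope a x1 y1 x2 y2 l"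
      and PQ: "ec_add a P Q = Affine (l^2 - x1 - x2) (l * (x1 - (l^2 - x1 - x2)) - y1)"
      using ec_add_affine[OF c(1,2) n12] unfolding \<open>P = _\<close> \<open>Q = _\<close> by blast
    obtain k where k: "is_slope a x2 y2 x3 y3 k"
      and QR: "ec_add a Q R = Affine (k^2 - x2 - x3) (k * (x2 - (k^2 - x2 - x3)) - y2)"
      using ec_add_affine[OF c(2,3) n23] unfolding \<open>Q = _\<close> \<open>R = _\<close> by blast
    define x4 where "x4 = l^2 - x1 - x2"
    define y4 where "y4 = l * (x1 - x4) - y1"
    define x5 where "x5 = k^2 - x3 - x2"
    define y5 where "y5 = k * (x3 - x5) - y3"
    have PQ': "ec_add a P Q = Affine x4 y4" unfolding PQ x4_def y4_def ..
    have "k * (x2 - (k^2 - x2 - x3)) - y2 = y5"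
      using k unfolding is_slope_def y5_def x5_def by Groebner_Basis.algebra
    then have QR': "ec_add a Q R = Affine x5 y5" unfolding QR by (simp add: x5_def)
    have c4: "y4^2 = x4^3 + a * x4 + b" using clo[OF on(1,2)] unfolding PQ' by simp
    have c5: "y5^2 = x5^3 + a * x5 + b" using clo[OF on(2,3)] unfolding QR' by simp
    have n43: "\<not> (x4 = x3 \<and> y4 = - y3)" using 6(6) unfolding PQ' by auto
    have n15: "\<not> (x1 = x5 \<and> y1 = - y5)" using 6(7) unfolding QR' by auto
    obtain m where m: "is_slope a x4 y4 x3 y3 m"
      and L: "ec_add a (Affine x4 y4) R = Affine (m^2 - x4 - x3) (m * (x4 - (m^2 - x4 - x3)) - y4)"
      using ec_add_affine[OF c4 c(3) n43] unfolding \<open>R = _\<close> by blast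
    obtain n where n: "is_slope a x1 y1 x5 y5 n"
      and N: "ec_add a P (Affine x5 y5) = Affine (n^2 - x1 - x5) (n * (x1 - (n^2 - x1 - x5)) - y1)"
      using ec_add_affine[OF c(1) c5 n15] unfolding \<open>P = _\<close> by blast
    have e1: "x3 - x1 = (k - l) * (l + m)"
      by (rule slope_triple[OF l k x4_def y4_def m n43])
    have e2: "x1 - x3 = (l - k) * (k + n)"
      by (rule slope_triple[OF is_slope_sym[OF k] is_slope_sym[OF l] x5_def y5_def is_slope_sym[OF n]])
        (use n15 in auto)
    show ?thesis
    proof (cases "k = l")
      case True
      \<comment> \<open>The points are collinear, and \<open>R = P\<close> follows.\<close>
      with e1 have "x3 = x1" by simp
      moreover have "l * (x2 - x1) = y2 - y1" "k * (x3 - x2) = y3 - y2"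
        using l k by (simp_all add: is_slope_def)
      then have "y3 = y1" using True \<open>x3 = x1\<close> by Groebner_Basis.algebra
      ultimately have "R = P" by simp
      then show ?thesis using on comm clo by metis
    next
      case False
      have "(k - l) * (l + m) = (k - l) * (k + n)" using e1 e2 by Groebner_Basis.algebra
      then have e: "l + m = k + n" using False by simp
      have X: "m^2 - x4 - x3 = n^2 - x1 - x5"
        using e e1 unfolding x4_def x5_def by Groebner_Basis.algebra
      have "m * (x4 - (m^2 - x4 - x3)) - y4 = n * (x1 - (m^2 - x4 - x3)) - y1"
        using e e1 l k m unfolding x4_def y4_def is_slope_def by Groebner_Basis.algebra
      then show ?thesis unfolding PQ' QR' L N X by simp
    qed
  qed
qed


lemma type_algebra_simps [simp]:
  "carrier (ring_of_type_algebra :: 'a::field ring) = UNIV"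
  "x \<otimes>\<^bsub>ring_of_type_algebra\<^esub> y = x * y" "x \<oplus>\<^bsub>ring_of_type_algebra\<^esub> y = x + y"
  "\<one>\<^bsub>ring_of_type_algebra\<^esub> = (1::'a)" "\<zero>\<^bsub>ring_of_type_algebra\<^esub> = (0::'a)"
  by (simp_all add: ring_of_type_algebra_def)

lemma type_algebra_inverse_simps [simp]:
  fixes x :: "'a::field"
  shows "\<ominus>\<^bsub>ring_of_type_algebra\<^esub> x = - x"
    and "x \<noteq> 0 \<Longrightarrow> inv\<^bsub>ring_of_type_algebra\<^esub> x = inverse x"
proof -
  interpret R: field "ring_of_type_algebra :: 'a ring" by (rule field_from_type_algebra)
  show "\<ominus>\<^bsub>ring_of_type_algebra\<^esub> x = - x"
    by (rule R.minus_equality) auto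
  show "x \<noteq> 0 \<Longrightarrow> inv\<^bsub>ring_of_type_algebra\<^esub> x = inverse x"
    by (rule R.comm_inv_char) auto
qed

text \<open>Subfields of a type of sort \<^class>\<open>field\<close>, in terms of the operations of the type.\<close>

lemma subfield_type_algebraI:
  fixes F :: "'a::field set"
  assumes "1 \<in> F" "\<And>x y. x \<in> F \<Longrightarrow> y \<in> F \<Longrightarrow> x + y \<in> F" "\<And>x. x \<in> F \<Longrightarrow> - x \<in> F"
    "\<And>x y. x \<in> F \<Longrightarrow> y \<in> F \<Longrightarrow> x * y \<in> F" "\<And>x. x \<in> F \<Longrightarrow> x \<noteq> 0 \<Longrightarrow> inverse x \<in> F"
  shows "subfield F ring_of_type_algebra"
proof -
  interpret R: field "ring_of_type_algebra :: 'a ring" by (rule field_from_type_algebra)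
  show ?thesis
    by (rule R.subfieldI', rule R.subringI) (use assms in auto)
qed

lemma subfield_type_algebraD:
  fixes F :: "'a::field set"
  assumes F: "subfield F ring_of_type_algebra"
  shows "0 \<in> F" "1 \<in> F" "x \<in> F \<Longrightarrow> - x \<in> F"
    "x \<in> F \<Longrightarrow> y \<in> F \<Longrightarrow> x + y \<in> F" "x \<in> F \<Longrightarrow> y \<in> F \<Longrightarrow> x - y \<in> F"
    "x \<in> F \<Longrightarrow> y \<in> F \<Longrightarrow> x * y \<in> F" "x \<in> F \<Longrightarrow> inverse x \<in> F"
    "x \<in> F \<Longrightarrow> y \<in> F \<Longrightarrow> x / y \<in> F" "x \<in> F \<Longrightarrow> x ^ k \<in> F"
    "of_nat k \<in> F" "of_int i \<in> F" "numeral v \<in> F"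
proof -
  interpret R: field "ring_of_type_algebra :: 'a ring" by (rule field_from_type_algebra)
  note r = subringE[OF subfieldE(1)[OF F], simplified]
  show *: "0 \<in> F" "1 \<in> F" "\<And>x. x \<in> F \<Longrightarrow> - x \<in> F" "\<And>x y. x \<in> F \<Longrightarrow> y \<in> F \<Longrightarrow> x + y \<in> F"
    "\<And>x y. x \<in> F \<Longrightarrow> y \<in> F \<Longrightarrow> x * y \<in> F"
    using r by auto
  show diff: "x \<in> F \<Longrightarrow> y \<in> F \<Longrightarrow> x - y \<in> F" for x y
    using *(3)[of y] *(4)[of x "- y"] by simp
  show inv: "inverse x \<in> F" if "x \<in> F" for x
  proof (cases "x = 0")
    case False
    then show ?thesis using R.subfield_m_inv(1)[OF F, of x] that by simp
  qed (use * in auto)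
  show "x / y \<in> F" if "x \<in> F" "y \<in> F" for x y
    unfolding divide_inverse using *(5)[OF that(1) inv[OF that(2)]] .
  show "x ^ k \<in> F" if "x \<in> F"
    by (induction k) (use that * in auto)
  show n: "of_nat k \<in> F" for k
    by (induction k) (use * in auto)
  show "of_int i \<in> F"
    by (cases i rule: int_cases2) (use n *(3) in auto)
  show "numeral v \<in> F"
    using n[of "numeral v"] by simp
qed

lemma subfield_Rats: "subfield (\<rat> :: 'a::field_char_0 set) ring_of_type_algebra"
  by (rule subfield_type_algebraI) auto

lemma ec_group_simps [simp]:
  "monoid.mult (ec_group a b F) = ec_add a" "\<one>\<^bsub>ec_group a b F\<^esub> = Infinity"
  "Infinity \<in> carrier (ec_group a b F)"
  "Affine x y \<in> carrier (ec_group a b F) \<longleftrightarrow> x \<in> F \<and> y \<in> F \<and> on_curve a b (Affine x y)"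
  by (auto simp: ec_group_def)

lemma carrier_ec_groupD: "P \<in> carrier (ec_group a b F) \<Longrightarrow> on_curve a b P"
  by (cases P) auto

lemma ec_neg_closed:
  "subfield F ring_of_type_algebra \<Longrightarrow> P \<in> carrier (ec_group a b F) \<Longrightarrow> ec_neg P \<in> carrier (ec_group a b F)"
  by (cases P) (auto intro: subfield_type_algebraD)

lemma ec_add_closed:
  fixes a :: "'a::field_char_0"
  assumes F: "subfield F ring_of_type_algebra" and a: "a \<in> F"
    and PQ: "P \<in> carrier (ec_group a b F)" "Q \<in> carrier (ec_group a b F)"
  shows "ec_add a P Q \<in> carrier (ec_group a b F)"
proof (cases "P = Infinity \<or> Q = Infinity")
  case False
  then obtain x1 y1 x2 y2 where [simp]: "P = Affine x1 y1" "Q = Affine x2 y2"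
    by (metis ec_point.exhaust)
  have on: "on_curve a b (ec_add a P Q)"
    using PQ by (intro on_curve_add carrier_ec_groupD)
  note F' = subfield_type_algebraD[OF F]
  show ?thesis
  proof (cases "x1 = x2 \<and> y1 = - y2")
    case False
    define l where "l = (if x1 = x2 then (3 * x1^2 + a) / (2 * y1) else (y2 - y1) / (x2 - x1))"
    have "l \<in> F" using PQ a by (auto simp: l_def intro!: F')
    moreover have eq: "ec_add a P Q = Affine (l^2 - x1 - x2) (l * (x1 - (l^2 - x1 - x2)) - y1)"
      using False by (simp add: ec_add.simps(3) l_def Let_def)
    ultimately show ?thesis
      using PQ on unfolding eq ec_group_simps by (auto intro!: F')
  qed auto
qed (use PQ in auto)

theorem comm_group_ec_group:
  fixes a :: "'a::field_char_0"
  assumes F: "subfield F ring_of_type_algebra" and a: "a \<in> F" and ns: "nonsingular a b"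
  shows "comm_group (ec_group a b F)"
proof (rule comm_groupI)
  fix P assume "P \<in> carrier (ec_group a b F)"
  then show "\<exists>Q\<in>carrier (ec_group a b F). Q \<otimes>\<^bsub>ec_group a b F\<^esub> P = \<one>\<^bsub>ec_group a b F\<^esub>"
    using ec_neg_closed[OF F] by (intro bexI[of _ "ec_neg P"]) auto
qed (auto intro: ec_add_closed[OF F a] ec_add_assoc[OF ns] ec_add_commute carrier_ec_groupD)

text \<open>The addition formulas commute with homomorphisms of subfields.\<close>

lemma map_ec_add:
  fixes a :: "'a::field_char_0"
  assumes F: "subfield F ring_of_type_algebra" and a: "a \<in> F" "s a = a"
    and add: "\<And>x y. x \<in> F \<Longrightarrow> y \<in> F \<Longrightarrow> s (x + y) = s x + s y"
    and mult: "\<And>x y. x \<in> F \<Longrightarrow> y \<in> F \<Longrightarrow> s (x * y) = s x * s y"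
    and one: "s 1 = 1" and inj: "inj_on s F"
    and PQ: "P \<in> carrier (ec_group a b F)" "Q \<in> carrier (ec_group a b F)"
  shows "map_ec_point s (ec_add a P Q) = ec_add a (map_ec_point s P) (map_ec_point s Q)"
proof (cases "P = Infinity \<or> Q = Infinity")
  case False
  then obtain x1 y1 x2 y2 where [simp]: "P = Affine x1 y1" "Q = Affine x2 y2"
    by (metis ec_point.exhaust)
  note F' = subfield_type_algebraD[OF F]
  have zero: "s 0 = 0" using add[of 0 0] F' by simp
  have neg: "s (- x) = - s x" if "x \<in> F" for x
    using add[of x "- x"] that zero F' by (simp add: eq_neg_iff_add_eq_0 add.commute)
  have diff: "s (x - y) = s x - s y" if "x \<in> F" "y \<in> F" for x y
    using add[of x "- y"] neg that F' by simp
  have inv: "s (inverse x) = inverse (s x)" if "x \<in> F" for x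
  proof (cases "x = 0")
    case False
    then have "s x * s (inverse x) = 1" using mult[of x "inverse x"] that F' one by simp
    then show ?thesis by (simp add: inverse_unique)
  qed (simp add: zero)
  have divi: "s (x / y) = s x / s y" if "x \<in> F" "y \<in> F" for x y
    using mult[of x "inverse y"] inv that F' by (simp add: divide_inverse)
  have sq: "s (x ^ 2) = s x ^ 2" if "x \<in> F" for x
    using that by (simp add: power2_eq_square mult)
  have two: "s 2 = 2" and three: "s 3 = 3"
    using add[of 1 1] add[of 1 2] one F' by simp_all
  have F: "x1 \<in> F" "x2 \<in> F" "y1 \<in> F" "y2 \<in> F" using PQ by auto
  have x: "s x1 = s x2 \<longleftrightarrow> x1 = x2" using inj F by (auto dest: inj_onD)
  have y: "s y1 = - s y2 \<longleftrightarrow> y1 = - y2"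
    using inj F neg[of y2] F'(3)[of y2] by (metis inj_onD)
  show ?thesis
    using F a F' unfolding \<open>P = _\<close> \<open>Q = _\<close>
    by (simp add: ec_add.simps(3) Let_def x y add mult diff divi sq two three)
qed auto

section \<open>The cyclic cubic field of \<open>X\<^sup>3 - t * X\<^sup>2 - (t + 3) * X - 1\<close>\<close>

lemma poly_g: "poly (g t) x = x^3 - of_int t * x^2 - (of_int t + 3) * x - 1"
  by (simp add: g_def algebra_simps power2_eq_square power3_eq_cube)

lemma no_rational_root:
  assumes "x \<in> \<rat>"
  shows "poly (g t) x \<noteq> 0"
proof
  assume root: "poly (g t) x = 0"
  from assms obtain p q :: int where q: "q > 0" and cop: "coprime p q" and x: "x = of_int p / of_int q"
    by (cases rule: Rats_cases') auto
  have "of_int p ^ 3 - of_int t * of_int p ^ 2 * of_int q - (of_int t + 3) * of_int p * of_int q ^ 2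
      - of_int q ^ 3 = (of_int q ^ 3 * poly (g t) x :: real)"
    using q by (simp add: poly_g x field_simps power2_eq_square power3_eq_cube)
  also have "\<dots> = of_int 0" using root by simp
  finally have "(of_int (p^3 - t * p^2 * q - (t + 3) * p * q^2 - q^3) :: real) = of_int 0" by simp
  then have eq: "p^3 - t * p^2 * q - (t + 3) * p * q^2 - q^3 = 0" by (simp only: of_int_eq_iff)
  have "p^3 = q * (t * p^2 + (t + 3) * p * q + q^2)" using eq by Groebner_Basis.algebra
  then have "q dvd p^3" by simp
  moreover have "coprime q (p^3)" using cop by (simp add: coprime_commute)
  ultimately have "is_unit q" by (metis coprime_common_divisor dvd_refl)
  with q have q1: "q = 1" by simp
  have "p * (p^2 - t * p - (t + 3)) = 1" using eq q1 by (simp add: algebra_simps power2_eq_square power3_eq_cube)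
  then have "p dvd 1" by (metis dvd_triv_left)
  then have "p = 1 \<or> p = - 1" by auto
  then show False
  proof
    assume "p = 1"
    then have "2 * t + 3 = 0" using eq q1 by simp
    then show False by presburger
  next
    assume "p = - 1"
    then show False using eq q1 by simp
  qed
qed

lemma root_irrational: "poly (g t) x = 0 \<Longrightarrow> x \<notin> \<rat>"
  using no_rational_root by blast

lemma root_independent:
  assumes root: "poly (g t) x = 0" and Q: "a \<in> \<rat>" "b \<in> \<rat>" "c \<in> \<rat>"
    and eq: "a + b * x + c * x^2 = 0"
  shows "a = 0 \<and> b = 0 \<and> c = 0"
proof -
  have x: "x \<notin> \<rat>" using root by (rule root_irrational)
  have lin: "u = 0 \<and> v = 0" if "u \<in> \<rat>" "v \<in> \<rat>" "u + v * x = 0" for u v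
  proof (cases "v = 0")
    case False
    then have "x = - u / v" using that(3) by (simp add: field_simps)
    then show ?thesis using x that by auto
  qed (use that in auto)
  have "c = 0"
  proof (rule ccontr)
    assume c: "c \<noteq> 0"
    define p q where "p = - b / c" and "q = - a / c"
    have [simp]: "p \<in> \<rat>" "q \<in> \<rat>" using Q by (auto simp: p_def q_def)
    have x2: "x^2 = p * x + q" using eq c by (simp add: p_def q_def field_simps)
    \<comment> \<open>The coefficients of the remainder of the cubic modulo \<open>X\<^sup>2 - p * X - q\<close>; the quotient is
      linear with root \<open>t - p\<close>.\<close>
    have "(p * q - of_int t * q - 1) + (p^2 + q - of_int t * p - of_int t - 3) * x = 0"
      using root x2 unfolding poly_g by Groebner_Basis.algebra
    then have "p * q - t * q - 1 = 0" "p^2 + q - t * p - t - 3 = 0"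
      using lin[of "p * q - t * q - 1" "p^2 + q - t * p - t - 3"] by auto
    then have "poly (g t) (t - p) = 0" unfolding poly_g by Groebner_Basis.algebra
    then show False using no_rational_root[of "t - p" t] by auto
  qed
  then show ?thesis using lin[of a b] Q eq by simp
qed

lemma root_coords_unique:
  assumes root: "poly (g t) x = 0"
    and Q: "a \<in> \<rat>" "b \<in> \<rat>" "c \<in> \<rat>" "a' \<in> \<rat>" "b' \<in> \<rat>" "c' \<in> \<rat>"
    and eq: "a + b * x + c * x^2 = a' + b' * x + c' * x^2"
  shows "a = a' \<and> b = b' \<and> c = c'"
  using root_independent[OF root, of "a - a'" "b - b'" "c - c'"] Q eq by (simp add: algebra_simps)

text \<open>The roots are permuted by \<open>x \<mapsto> - 1 / (x + 1)\<close>, a map of order three.\<close>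

definition rho :: "real \<Rightarrow> real" where
  "rho x = - 1 / (x + 1)"

lemma root_nonzero: "poly (g t) x = 0 \<Longrightarrow> x \<noteq> 0 \<and> x + 1 \<noteq> 0"
  using root_irrational[of t x] by (auto simp: add_eq_0_iff2)

lemma rho_eq:
  assumes "poly (g t) x = 0"
  shows "rho x = x^2 - (of_int t + 1) * x - 2" "rho (rho x) = of_int t + 2 + of_int t * x - x^2"
    "rho (rho (rho x)) = x" "poly (g t) (rho x) = 0"
proof -
  have x: "x \<noteq> 0" "x + 1 \<noteq> 0" using root_nonzero[OF assms] by auto
  have r1: "rho x * (x + 1) = - 1" using x by (simp add: rho_def)
  have "(rho x - (x^2 - (of_int t + 1) * x - 2)) * (x + 1) = 0"
    using r1 assms unfolding poly_g by Groebner_Basis.algebra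
  then show 1: "rho x = x^2 - (of_int t + 1) * x - 2" using x by simp
  then show "poly (g t) (rho x) = 0" using assms unfolding poly_g by Groebner_Basis.algebra
  have r2: "rho (rho x) = - (x + 1) / x" using x by (simp add: rho_def field_simps)
  have "(rho (rho x) - (of_int t + 2 + of_int t * x - x^2)) * x = 0"
    using assms x unfolding r2 poly_g by (simp add: field_simps power2_eq_square power3_eq_cube)
  then show "rho (rho x) = of_int t + 2 + of_int t * x - x^2" using x by simp
  show "rho (rho (rho x)) = x" unfolding r2 using x by (simp add: rho_def field_simps)
qed

lemma rho_symmetric:
  assumes "poly (g t) x = 0"
  shows "x + rho x + rho (rho x) = of_int t" "x * rho x + x * rho (rho x) + rho x * rho (rho x) = - (of_int t + 3)"
    "x * rho x * rho (rho x) = 1"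
proof -
  note r = rho_eq(1,2)[OF assms]
  show "x + rho x + rho (rho x) = of_int t"
    "x * rho x + x * rho (rho x) + rho x * rho (rho x) = - (of_int t + 3)"
    "x * rho x * rho (rho x) = 1"
    using assms unfolding r(2) unfolding r(1) poly_g by - (Groebner_Basis.algebra+)
qed

text \<open>The rational vector space spanned by \<open>1\<close>, \<open>x\<close>, \<open>x\<^sup>2\<close>; for a root \<open>x\<close> of the cubic it is the
  field generated by \<open>x\<close>.\<close>

definition cubic_span :: "real \<Rightarrow> real set" where
  "cubic_span x = {a + b * x + c * x^2 | a b c. a \<in> \<rat> \<and> b \<in> \<rat> \<and> c \<in> \<rat>}"

lemma cubic_spanI: "a \<in> \<rat> \<Longrightarrow> b \<in> \<rat> \<Longrightarrow> c \<in> \<rat> \<Longrightarrow> a + b * x + c * x^2 \<in> cubic_span x"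
  by (auto simp: cubic_span_def)

lemma cubic_spanE:
  assumes "y \<in> cubic_span x"
  obtains a b c where "y = a + b * x + c * x^2" "a \<in> \<rat>" "b \<in> \<rat>" "c \<in> \<rat>"
  using assms by (auto simp: cubic_span_def)

lemma cubic_span_mult_eq:
  assumes "poly (g t) x = 0"
  shows "(a + b * x + c * x^2) * (a' + b' * x + c' * x^2)
    = (a * a' + (b * c' + c * b') + c * c' * of_int t)
      + (a * b' + b * a' + (b * c' + c * b') * (of_int t + 3) + c * c' * (of_int t^2 + 3 * of_int t + 1)) * x
      + (a * c' + b * b' + c * a' + (b * c' + c * b') * of_int t + c * c' * (of_int t^2 + of_int t + 3)) * x^2"
  using assms unfolding poly_g by Groebner_Basis.algebra

lemma cubic_span_mult:
  assumes "poly (g t) x = 0" "y \<in> cubic_span x" "z \<in> cubic_span x"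
  shows "y * z \<in> cubic_span x"
  using assms(2,3)
  by (elim cubic_spanE) (auto simp: cubic_span_mult_eq[OF assms(1)] intro!: cubic_spanI)

lemma cubic_span_add: "y \<in> cubic_span x \<Longrightarrow> z \<in> cubic_span x \<Longrightarrow> y + z \<in> cubic_span x"
proof (elim cubic_spanE)
  fix a b c a' b' c'
  assume "y = a + b * x + c * x^2" "z = a' + b' * x + c' * x^2"
    "a \<in> \<rat>" "b \<in> \<rat>" "c \<in> \<rat>" "a' \<in> \<rat>" "b' \<in> \<rat>" "c' \<in> \<rat>"
  then show ?thesis
    using cubic_spanI[of "a + a'" "b + b'" "c + c'" x] by (simp add: algebra_simps)
qed

lemma Rats_in_cubic_span: "a \<in> \<rat> \<Longrightarrow> a \<in> cubic_span x"
  using cubic_spanI[of a 0 0 x] by simp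

text \<open>The norm, written through the elementary symmetric functions of the roots, is rational.\<close>

lemma cubic_norm:
  assumes "poly (g t) x = 0"
  shows "(a + b * x + c * x^2) * (a + b * rho x + c * rho x ^ 2) * (a + b * rho (rho x) + c * rho (rho x) ^ 2)
    = a^3 + a^2 * b * of_int t + a^2 * c * (of_int t^2 + 2 * (of_int t + 3)) - a * b^2 * (of_int t + 3)
      - a * b * c * (of_int t * (of_int t + 3) + 3) + a * c^2 * ((of_int t + 3)^2 - 2 * of_int t) + b^3 + b^2 * c * of_int t
      - b * c^2 * (of_int t + 3) + c^3"
proof -
  have "(a + b * x + c * x^2) * (a + b * y + c * y^2) * (a + b * z + c * z^2)
    = a^3 + a^2 * b * (x + y + z) + a^2 * c * ((x + y + z)^2 - 2 * (x * y + x * z + y * z))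
      + a * b^2 * (x * y + x * z + y * z)
      + a * b * c * ((x + y + z) * (x * y + x * z + y * z) - 3 * (x * y * z))
      + a * c^2 * ((x * y + x * z + y * z)^2 - 2 * (x + y + z) * (x * y * z)) + b^3 * (x * y * z)
      + b^2 * c * (x + y + z) * (x * y * z) + b * c^2 * (x * y + x * z + y * z) * (x * y * z)
      + c^3 * (x * y * z)^2"
    for y z by Groebner_Basis.algebra
  from this[of "rho x" "rho (rho x)"] show ?thesis
    unfolding rho_symmetric[OF assms] by (rule trans) (simp add: algebra_simps power2_eq_square)
qed

lemma rho_in_cubic_span:
  assumes "poly (g t) x = 0"
  shows "rho x \<in> cubic_span x" "rho (rho x) \<in> cubic_span x"
proof -
  show "rho x \<in> cubic_span x"
    using cubic_spanI[of "- 2" "- (of_int t + 1)" 1 x] unfolding rho_eq(1)[OF assms]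
    by (simp add: algebra_simps)
  show "rho (rho x) \<in> cubic_span x"
    using cubic_spanI[of "of_int t + 2" "of_int t" "- 1" x] unfolding rho_eq(2)[OF assms]
    by (simp add: algebra_simps)
qed

text \<open>The inverse is the product of the two conjugates divided by the norm.\<close>

lemma cubic_span_inverse:
  assumes root: "poly (g t) x = 0" and y: "y \<in> cubic_span x" "y \<noteq> 0"
  shows "inverse y \<in> cubic_span x"
proof -
  from y(1) obtain a b c where eq: "y = a + b * x + c * x^2" and Q: "a \<in> \<rat>" "b \<in> \<rat>" "c \<in> \<rat>"
    by (rule cubic_spanE)
  have nz: "a + b * z + c * z^2 \<noteq> 0" if "poly (g t) z = 0" for z
  proof
    assume "a + b * z + c * z^2 = 0"
    then have "a = 0 \<and> b = 0 \<and> c = 0" using root_independent[OF that Q] by simp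
    then show False using y eq by simp
  qed
  define w where "w = (a + b * rho x + c * rho x ^ 2) * (a + b * rho (rho x) + c * rho (rho x) ^ 2)"
  have w: "w \<in> cubic_span x" unfolding w_def power2_eq_square
    by (intro cubic_span_mult[OF root] cubic_span_add Rats_in_cubic_span Q rho_in_cubic_span[OF root])
  have "y * w \<in> \<rat>" unfolding w_def eq mult.assoc[symmetric] cubic_norm[OF root] using Q by auto
  moreover have "w \<noteq> 0"
    using nz rho_eq(4)[OF root] rho_eq(4)[OF rho_eq(4)[OF root]] by (simp add: w_def)
  then have "inverse y = w * inverse (y * w)" using y by (simp add: field_simps)
  ultimately show ?thesis
    using cubic_span_mult[OF root w, of "inverse (y * w)"] Rats_in_cubic_span[of "inverse (y * w)" x]
      Rats_inverse by metis
qed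

lemma subfield_cubic_span:
  assumes root: "poly (g t) x = 0"
  shows "subfield (cubic_span x) ring_of_type_algebra"
proof (rule subfield_type_algebraI)
  fix y assume y: "y \<in> cubic_span x"
  show "- y \<in> cubic_span x"
    using cubic_span_mult[OF root Rats_in_cubic_span[of "-1"] y] by simp
qed (auto intro: cubic_span_add cubic_span_mult[OF root] cubic_span_inverse[OF root] Rats_in_cubic_span)

lemma theta_root:
  assumes "t \<ge> - 1"
  shows "poly (g t) (theta t) = 0"
proof -
  have "g t \<noteq> 0" by (simp add: g_def)
  then have fin: "finite {x. poly (g t) x = 0}" by (rule poly_roots_finite)
  have "poly (g t) (real_of_int t + 3) = 2 * (real_of_int t + 3)^2 - 1"
    unfolding poly_g by Groebner_Basis.algebra
  moreover have "2 * (real_of_int t + 3)^2 > 1"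
  proof -
    have "real_of_int t + 3 \<ge> 1" using assms by linarith
    then have "(real_of_int t + 3)^2 \<ge> 1" by simp
    then show ?thesis by linarith
  qed
  ultimately have "poly (g t) (real_of_int t + 3) > 0" by simp
  moreover have "poly (g t) 0 < 0" by (simp add: poly_g)
  ultimately obtain x where "poly (g t) x = 0"
    using poly_IVT_pos[of 0 "real_of_int t + 3" "g t"] assms by auto
  then have "{x. poly (g t) x = 0} \<noteq> {}" by auto
  from Max_in[OF fin this] show ?thesis by (simp add: theta_def)
qed

text \<open>
  Only that \<open>\<theta>\<close> is a root matters below, not that it is the largest one.
\<close>

locale simplest_cubic =
  fixes t :: int
  assumes t: "t \<ge> - 1"
begin

abbreviation "\<theta> \<equiv> theta t"

lemmas root = theta_root[OF t]

lemma K_eq: "K t = cubic_span \<theta>"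
proof
  interpret R: field "ring_of_type_algebra :: real ring" by (rule field_from_type_algebra)
  show "K t \<subseteq> cubic_span \<theta>"
    unfolding K_def
    by (rule R.generate_field_min_subfield1)
      (use subfield_cubic_span[OF root] cubic_spanI[of 0 1 0 \<theta>] in auto)
  have K: "subfield (K t) ring_of_type_algebra"
    unfolding K_def by (rule R.generate_field_is_subfield) simp
  note K' = subfield_type_algebraD[OF K]
  have "\<theta> \<in> K t" unfolding K_def by (rule generate_field.incl) simp
  moreover have "a \<in> K t" if "a \<in> \<rat>" for a
    using that by (cases rule: Rats_cases') (auto intro: K')
  ultimately show "cubic_span \<theta> \<subseteq> K t" by (auto elim!: cubic_spanE intro!: K')
qed

lemma subfield_K: "subfield (K t) ring_of_type_algebra"
  unfolding K_eq by (rule subfield_cubic_span[OF root])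

lemmas K_closed = subfield_type_algebraD[OF subfield_K]

lemma Rats_subset_K: "\<rat> \<subseteq> K t"
  using Rats_in_cubic_span by (auto simp: K_eq)

lemma theta_in_K: "\<theta> \<in> K t"
  using cubic_spanI[of 0 1 0 \<theta>] by (simp add: K_eq)

text \<open>
  The automorphism \<open>\<sigma>\<close>, given by its values in the basis \<open>1\<close>, \<open>\<theta>\<close>, \<open>\<theta>\<^sup>2\<close>. It is undefined outside
  \<open>K t\<close>, in accordance with the extensional functions in \<^const>\<open>Gal\<close>.
\<close>

definition sigma0 :: "real \<Rightarrow> real" where
  "sigma0 = (\<lambda>x\<in>K t. THE y. \<exists>a\<in>\<rat>. \<exists>b\<in>\<rat>. \<exists>c\<in>\<rat>. x = a + b * \<theta> + c * \<theta>^2 \<and> y = a + b * rho \<theta> + c * rho \<theta> ^ 2)"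

lemma sigma0_eq:
  assumes Q: "a \<in> \<rat>" "b \<in> \<rat>" "c \<in> \<rat>"
  shows "sigma0 (a + b * \<theta> + c * \<theta>^2) = a + b * rho \<theta> + c * rho \<theta> ^ 2"
proof -
  have "(THE y. \<exists>a'\<in>\<rat>. \<exists>b'\<in>\<rat>. \<exists>c'\<in>\<rat>. a + b * \<theta> + c * \<theta>^2 = a' + b' * \<theta> + c' * \<theta>^2
      \<and> y = a' + b' * rho \<theta> + c' * rho \<theta> ^ 2) = a + b * rho \<theta> + c * rho \<theta> ^ 2"
  proof (rule the_equality)
    fix y assume "\<exists>a'\<in>\<rat>. \<exists>b'\<in>\<rat>. \<exists>c'\<in>\<rat>. a + b * \<theta> + c * \<theta>^2 = a' + b' * \<theta> + c' * \<theta>^2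
      \<and> y = a' + b' * rho \<theta> + c' * rho \<theta> ^ 2"
    then show "y = a + b * rho \<theta> + c * rho \<theta> ^ 2"
      using root_coords_unique[OF root Q] by blast
  qed (use Q in blast)
  then show ?thesis using cubic_spanI[OF Q] by (simp add: sigma0_def K_eq)
qed

lemma sigma0_add:
  assumes "x \<in> K t" "y \<in> K t"
  shows "sigma0 (x + y) = sigma0 x + sigma0 y"
proof -
  from assms obtain a b c a' b' c' where x: "x = a + b * \<theta> + c * \<theta>^2" "a \<in> \<rat>" "b \<in> \<rat>" "c \<in> \<rat>"
    and y: "y = a' + b' * \<theta> + c' * \<theta>^2" "a' \<in> \<rat>" "b' \<in> \<rat>" "c' \<in> \<rat>"
    unfolding K_eq by (metis cubic_spanE)
  have "x + y = (a + a') + (b + b') * \<theta> + (c + c') * \<theta>^2" by (simp add: x y algebra_simps)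
  moreover have "a + a' \<in> \<rat>" "b + b' \<in> \<rat>" "c + c' \<in> \<rat>" using x y by auto
  ultimately have "sigma0 (x + y) = (a + a') + (b + b') * rho \<theta> + (c + c') * rho \<theta> ^ 2"
    by (simp only: sigma0_eq)
  also have "\<dots> = sigma0 x + sigma0 y"
    unfolding x(1) y(1) sigma0_eq[OF x(2-4)] sigma0_eq[OF y(2-4)] by (simp add: algebra_simps)
  finally show ?thesis .
qed

lemma sigma0_mult:
  assumes "x \<in> K t" "y \<in> K t"
  shows "sigma0 (x * y) = sigma0 x * sigma0 y"
proof -
  from assms obtain a b c a' b' c' where x: "x = a + b * \<theta> + c * \<theta>^2" "a \<in> \<rat>" "b \<in> \<rat>" "c \<in> \<rat>"
    and y: "y = a' + b' * \<theta> + c' * \<theta>^2" "a' \<in> \<rat>" "b' \<in> \<rat>" "c' \<in> \<rat>"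
    unfolding K_eq by (metis cubic_spanE)
  show ?thesis
    unfolding x(1) y(1) cubic_span_mult_eq[OF root] sigma0_eq[OF x(2-4)] sigma0_eq[OF y(2-4)]
      cubic_span_mult_eq[OF rho_eq(4)[OF root]]
    by (rule sigma0_eq) (use x y in auto)
qed

lemma sigma0_Rats: "a \<in> \<rat> \<Longrightarrow> sigma0 a = a"
  using sigma0_eq[of a 0 0] by simp

lemma sigma0_theta: "sigma0 \<theta> = rho \<theta>"
  using sigma0_eq[of 0 1 0] by simp

lemma sigma0_closed:
  assumes "x \<in> K t"
  shows "sigma0 x \<in> K t"
proof -
  from assms obtain a b c where x: "x = a + b * \<theta> + c * \<theta>^2" "a \<in> \<rat>" "b \<in> \<rat>" "c \<in> \<rat>"
    unfolding K_eq by (metis cubic_spanE)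
  moreover have "rho \<theta> \<in> K t" using rho_in_cubic_span[OF root] by (simp add: K_eq)
  ultimately show ?thesis
    unfolding x(1) sigma0_eq[OF x(2-4)] using Rats_subset_K by (auto intro!: K_closed)
qed

text \<open>A map fixing the rationals and compatible with the operations is determined by the image of \<open>\<theta>\<close>.\<close>

lemma hom_eq:
  assumes add: "\<And>x y. x \<in> K t \<Longrightarrow> y \<in> K t \<Longrightarrow> s (x + y) = s x + s y"
    and mult: "\<And>x y. x \<in> K t \<Longrightarrow> y \<in> K t \<Longrightarrow> s (x * y) = s x * s y"
    and rat: "\<And>x. x \<in> \<rat> \<Longrightarrow> s x = x"
    and Q: "a \<in> \<rat>" "b \<in> \<rat>" "c \<in> \<rat>"
  shows "s (a + b * \<theta> + c * \<theta>^2) = a + b * s \<theta> + c * s \<theta> ^ 2"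
  using Q Rats_subset_K theta_in_K
  by (simp add: add mult rat power2_eq_square K_closed subset_iff)

lemma sigma0_sigma0_sigma0:
  assumes "x \<in> K t"
  shows "sigma0 (sigma0 (sigma0 x)) = x"
proof -
  from assms obtain a b c where x: "x = a + b * \<theta> + c * \<theta>^2" "a \<in> \<rat>" "b \<in> \<rat>" "c \<in> \<rat>"
    unfolding K_eq by (metis cubic_spanE)
  have rec: "sigma0 (rho z) = rho (sigma0 z)" if z: "z \<in> K t" "z + 1 \<noteq> 0" for z
  proof -
    have "rho z \<in> K t" unfolding rho_def by (intro K_closed z)
    then have "sigma0 (rho z * (z + 1)) = sigma0 (rho z) * (sigma0 z + 1)"
      using z by (simp add: sigma0_mult sigma0_add K_closed sigma0_Rats)
    moreover have "rho z * (z + 1) = - 1" using z by (simp add: rho_def)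
    ultimately have "sigma0 (rho z) * (sigma0 z + 1) = - 1" by (simp add: sigma0_Rats)
    moreover from this have "sigma0 z + 1 \<noteq> 0" by auto
    ultimately show ?thesis by (simp add: rho_def field_simps)
  qed
  have "sigma0 (rho (rho \<theta>)) = \<theta>" "sigma0 (rho \<theta>) = rho (rho \<theta>)"
    using rec[of \<theta>] rec[of "rho \<theta>"] theta_in_K root_nonzero[OF root]
      root_nonzero[OF rho_eq(4)[OF root]] rho_eq(3)[OF root]
      rho_in_cubic_span[OF root] by (simp_all add: sigma0_theta K_eq)
  then have th: "sigma0 (sigma0 (sigma0 \<theta>)) = \<theta>" by (simp add: sigma0_theta)
  show ?thesis
    unfolding x(1)
    by (subst hom_eq[where s = "\<lambda>x. sigma0 (sigma0 (sigma0 x))"])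
      (use x th in \<open>auto simp: sigma0_add sigma0_mult sigma0_closed sigma0_Rats\<close>)
qed

lemma sigma0_Gal: "sigma0 \<in> Gal (K t) \<rat>"
proof -
  have "bij_betw sigma0 (K t) (K t)"
    by (rule bij_betw_byWitness[where f' = "\<lambda>x. sigma0 (sigma0 x)"])
      (auto simp: sigma0_sigma0_sigma0 sigma0_closed)
  then show ?thesis
    unfolding Gal_def ring_iso_def
  proof (intro CollectI conjI ballI)
    show "sigma0 \<in> extensional (K t)" by (simp add: sigma0_def)
  qed (auto simp: sigma0_Rats sigma0_closed sigma0_add sigma0_mult intro!: ring_hom_memI)
qed

lemma sigma_eq_sigma0: "sigma t = sigma0"
  unfolding sigma_def
proof (rule the_equality)
  show "sigma0 \<in> Gal (K t) \<rat> \<and> sigma0 \<theta> = - 1 / (\<theta> + 1)"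
    using sigma0_Gal sigma0_theta by (simp add: rho_def)
next
  fix s assume s: "s \<in> Gal (K t) \<rat> \<and> s \<theta> = - 1 / (\<theta> + 1)"
  then have hom: "s \<in> ring_hom (ring_of_type_algebra\<lparr>carrier := K t\<rparr>) (ring_of_type_algebra\<lparr>carrier := K t\<rparr>)"
    and ext: "s \<in> extensional (K t)" and rat: "\<And>x. x \<in> \<rat> \<Longrightarrow> s x = x"
    by (auto simp: Gal_def ring_iso_def)
  show "s = sigma0"
  proof (rule extensionalityI[OF ext])
    show "sigma0 \<in> extensional (K t)" by (simp add: sigma0_def)
    fix x assume "x \<in> K t"
    then obtain a b c where x: "x = a + b * \<theta> + c * \<theta>^2" "a \<in> \<rat>" "b \<in> \<rat>" "c \<in> \<rat>"
      unfolding K_eq by (metis cubic_spanE)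
    show "s x = sigma0 x"
      unfolding x(1) sigma0_eq[OF x(2-4)]
      by (subst hom_eq[where s = s])
        (use x s rat ring_hom_mult[OF hom] ring_hom_add[OF hom] in \<open>auto simp: rho_def\<close>)
  qed
qed

lemmas sigma_add = sigma0_add[folded sigma_eq_sigma0]
lemmas sigma_mult = sigma0_mult[folded sigma_eq_sigma0]
lemmas sigma_Rats = sigma0_Rats[folded sigma_eq_sigma0]
lemmas sigma_theta = sigma0_theta[folded sigma_eq_sigma0]
lemmas sigma_closed = sigma0_closed[folded sigma_eq_sigma0]
lemmas sigma_sigma_sigma = sigma0_sigma0_sigma0[folded sigma_eq_sigma0]

lemma sigma_inj: "inj_on (sigma t) (K t)"
  by (rule inj_on_inverseI[where g = "\<lambda>x. sigma t (sigma t x)"]) (rule sigma_sigma_sigma)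

lemma sigma_fixed:
  assumes "x \<in> K t" "sigma t x = x"
  shows "x \<in> \<rat>"
proof -
  from assms(1) obtain a b c where x: "x = a + b * \<theta> + c * \<theta>^2" "a \<in> \<rat>" "b \<in> \<rat>" "c \<in> \<rat>"
    unfolding K_eq by (metis cubic_spanE)
  have "a + b * rho \<theta> + c * rho \<theta> ^ 2 = a + b * \<theta> + c * \<theta>^2"
    using assms(2) unfolding x(1) sigma_eq_sigma0 sigma0_eq[OF x(2-4)] .
  then have "(rho \<theta> - \<theta>) * (b + c * (\<theta> + rho \<theta>)) = 0" by Groebner_Basis.algebra
  moreover have "rho \<theta> \<noteq> \<theta>"
  proof
    assume "rho \<theta> = \<theta>"
    then have "- 2 + (- (of_int t + 1) - 1) * \<theta> + 1 * \<theta>^2 = 0"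
      using rho_eq(1)[OF root] by (simp add: algebra_simps)
    then show False using root_independent[OF root, of "-2" "- (of_int t + 1) - 1" 1] by auto
  qed
  ultimately have "b + c * (\<theta> + rho \<theta>) = 0" by simp
  then have "(b - 2 * c) + (- c * of_int t) * \<theta> + c * \<theta>^2 = 0"
    using rho_eq(1)[OF root] by (simp add: algebra_simps)
  then have "b - 2 * c = 0 \<and> - c * of_int t = 0 \<and> c = 0"
    using x by (intro root_independent[OF root]) auto
  then show ?thesis using x by simp
qed

end

section \<open>Points of infinite order\<close>

context simplest_cubic
begin

text \<open>
  The localisation of \<open>\<int>[\<theta>]\<close> at the prime 2. The cubic is irreducible modulo 2, so 2 is inert, and
  the elements not divisible by 2 are closed under multiplication.
\<close>

definition two_integers :: "real set" where
  "two_integers = {x. \<exists>a b c d :: int. odd d \<and> of_int d * x = of_int a + of_int b * \<theta> + of_int c * \<theta>^2}"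

text \<open>The elements not divisible by 2, which are the units of the localisation: the numerator has odd content.\<close>

definition two_units :: "real set" where
  "two_units = {x. \<exists>a b c d :: int. odd d \<and> \<not> (even a \<and> even b \<and> even c) \<and>
     of_int d * x = of_int a + of_int b * \<theta> + of_int c * \<theta>^2}"

lemma two_units_subset: "x \<in> two_units \<Longrightarrow> x \<in> two_integers"
  by (auto simp: two_integers_def two_units_def)

lemma int_coords_unique:
  assumes "of_int a + of_int b * \<theta> + of_int c * \<theta>^2 = of_int a' + of_int b' * \<theta> + of_int c' * \<theta>^2"
  shows "a = a' \<and> b = b' \<and> c = c'"
  using root_coords_unique[OF root _ _ _ _ _ _ assms] by auto

lemma int_coords_mult:
  "(of_int a + of_int b * \<theta> + of_int c * \<theta>^2) * (of_int a' + of_int b' * \<theta> + of_int c' * \<theta>^2)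
    = of_int (a * a' + (b * c' + c * b') + c * c' * t)
      + of_int (a * b' + b * a' + (b * c' + c * b') * (t + 3) + c * c' * (t^2 + 3 * t + 1)) * \<theta>
      + of_int (a * c' + b * b' + c * a' + (b * c' + c * b') * t + c * c' * (t^2 + t + 3)) * \<theta>^2"
  unfolding cubic_span_mult_eq[OF root] by simp

lemma two_units_mult:
  assumes "x \<in> two_units" "y \<in> two_units"
  shows "x * y \<in> two_units"
proof -
  from assms obtain a b c d a' b' c' d' where
    x: "odd d" "\<not> (even a \<and> even b \<and> even c)" "of_int d * x = of_int a + of_int b * \<theta> + of_int c * \<theta>^2"
    and y: "odd d'" "\<not> (even a' \<and> even b' \<and> even c')"
      "of_int d' * y = of_int a' + of_int b' * \<theta> + of_int c' * \<theta>^2"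
    unfolding two_units_def by blast
  have eq: "of_int (d * d') * (x * y)
    = of_int (a * a' + (b * c' + c * b') + c * c' * t)
      + of_int (a * b' + b * a' + (b * c' + c * b') * (t + 3) + c * c' * (t^2 + 3 * t + 1)) * \<theta>
      + of_int (a * c' + b * b' + c * a' + (b * c' + c * b') * t + c * c' * (t^2 + t + 3)) * \<theta>^2"
    unfolding int_coords_mult[symmetric] x(3)[symmetric] y(3)[symmetric] by simp
  \<comment> \<open>Irreducibility modulo 2, checked on the parities of the coefficients for each parity of \<open>t\<close>.\<close>
  have "\<not> (even (a * a' + (b * c' + c * b') + c * c' * t)
      \<and> even (a * b' + b * a' + (b * c' + c * b') * (t + 3) + c * c' * (t^2 + 3 * t + 1))
      \<and> even (a * c' + b * b' + c * a' + (b * c' + c * b') * t + c * c' * (t^2 + t + 3)))"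
    using x(2) y(2) by (cases "even t"; cases "even a"; cases "even b"; cases "even c") auto
  with eq x(1) y(1) show ?thesis unfolding two_units_def by (simp only: mem_Collect_eq) (metis even_mult_iff)
qed

lemma two_integers_add:
  assumes "x \<in> two_integers" "y \<in> two_integers"
  shows "x + y \<in> two_integers"
proof -
  from assms obtain a b c d a' b' c' d' where
    x: "odd d" "of_int d * x = of_int a + of_int b * \<theta> + of_int c * \<theta>^2"
    and y: "odd d'" "of_int d' * y = of_int a' + of_int b' * \<theta> + of_int c' * \<theta>^2"
    unfolding two_integers_def by blast
  have "of_int (d * d') * (x + y) = of_int d' * (of_int d * x) + of_int d * (of_int d' * y)"
    by (simp add: algebra_simps)
  also have "\<dots> = of_int (d' * a + d * a') + of_int (d' * b + d * b') * \<theta> + of_int (d' * c + d * c') * \<theta>^2"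
    unfolding x y by (simp add: algebra_simps)
  finally show ?thesis
    using x(1) y(1) unfolding two_integers_def by (simp only: mem_Collect_eq) (metis even_mult_iff)
qed

lemma two_integers_mult_int:
  assumes "x \<in> two_integers"
  shows "of_int k * x \<in> two_integers"
proof -
  from assms obtain a b c d where
    x: "odd d" "of_int d * x = of_int a + of_int b * \<theta> + of_int c * \<theta>^2"
    unfolding two_integers_def by blast
  have "of_int d * (of_int k * x) = of_int (k * a) + of_int (k * b) * \<theta> + of_int (k * c) * \<theta>^2"
    using arg_cong[OF x(2), of "\<lambda>z. of_int k * z"] by (simp add: algebra_simps)
  then show ?thesis using x(1) unfolding two_integers_def by blast
qed

lemma two_units_add_even:
  assumes "x \<in> two_units" "y \<in> two_integers"
  shows "x + 2 * y \<in> two_units"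
proof -
  from assms obtain a b c d a' b' c' d' where
    x: "odd d" "\<not> (even a \<and> even b \<and> even c)" "of_int d * x = of_int a + of_int b * \<theta> + of_int c * \<theta>^2"
    and y: "odd d'" "of_int d' * y = of_int a' + of_int b' * \<theta> + of_int c' * \<theta>^2"
    unfolding two_integers_def two_units_def by blast
  have "of_int (d * d') * (x + 2 * y) = of_int d' * (of_int d * x) + 2 * of_int d * (of_int d' * y)"
    by (simp add: algebra_simps)
  also have "\<dots> = of_int (d' * a + 2 * d * a') + of_int (d' * b + 2 * d * b') * \<theta> + of_int (d' * c + 2 * d * c') * \<theta>^2"
    unfolding x y by (simp add: algebra_simps)
  finally have "of_int (d * d') * (x + 2 * y) = \<dots>" .
  moreover have "\<not> (even (d' * a + 2 * d * a') \<and> even (d' * b + 2 * d * b') \<and> even (d' * c + 2 * d * c'))"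
    using x y by auto
  ultimately show ?thesis
    using x(1) y(1) unfolding two_units_def by (simp only: mem_Collect_eq) (metis even_mult_iff)
qed

lemma two_units_not_even:
  assumes "y \<in> two_integers"
  shows "2 * y \<notin> two_units"
proof
  assume "2 * y \<in> two_units"
  with assms obtain a b c d a' b' c' d' where
    x: "odd d" "\<not> (even a \<and> even b \<and> even c)" "of_int d * (2 * y) = of_int a + of_int b * \<theta> + of_int c * \<theta>^2"
    and y: "odd d'" "of_int d' * y = of_int a' + of_int b' * \<theta> + of_int c' * \<theta>^2"
    unfolding two_integers_def two_units_def by blast
  have "of_int d' * (of_int d * (2 * y)) = 2 * of_int d * (of_int d' * y)"
    by (simp add: algebra_simps)
  then have "of_int (d' * a) + of_int (d' * b) * \<theta> + of_int (d' * c) * \<theta>^2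
      = of_int (2 * d * a') + of_int (2 * d * b') * \<theta> + of_int (2 * d * c') * \<theta>^2"
    unfolding x(3) y(2) by (simp add: algebra_simps)
  then have "d' * a = 2 * d * a' \<and> d' * b = 2 * d * b' \<and> d' * c = 2 * d * c'"
    by (rule int_coords_unique)
  then have "even (d' * a) \<and> even (d' * b) \<and> even (d' * c)" by auto
  with x y show False by auto
qed

text \<open>
  \<open>val x k\<close> states that the 2-adic valuation of \<open>x\<close> is \<open>k\<close>. As a relation it needs no value at
  zero, where it never holds.
\<close>

definition val :: "real \<Rightarrow> int \<Rightarrow> bool" where
  "val x k \<longleftrightarrow> (\<exists>u\<in>two_units. x = 2 powi k * u)"

lemma val_ge:
  assumes "val x k" "x = 2 powi l * y" "y \<in> two_integers"
  shows "k \<ge> l"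
proof (rule ccontr)
  assume "\<not> k \<ge> l"
  then obtain j where l: "l = k + 1 + int j" using zle_iff_zadd[of "k + 1" l] by auto
  from assms(1) obtain u where u: "u \<in> two_units" "x = 2 powi k * u" by (auto simp: val_def)
  have "2 powi l = (2 powi k * (2 * 2 ^ j) :: real)" by (simp add: l power_int_add)
  then have "u = 2 * (of_int (2 ^ j) * y)" using u assms(2) by simp
  then show False
    using two_units_not_even[OF two_integers_mult_int[OF assms(3)]] u(1) by metis
qed

lemma val_unique: "val x k \<Longrightarrow> val x l \<Longrightarrow> k = l"
  using val_ge two_units_subset unfolding val_def by (metis order_antisym)

lemma val_mult: "val x k \<Longrightarrow> val y l \<Longrightarrow> val (x * y) (k + l)"
proof -
  assume "val x k" "val y l"
  then obtain u w where "u \<in> two_units" "x = 2 powi k * u" "w \<in> two_units" "y = 2 powi l * w"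
    by (auto simp: val_def)
  then show ?thesis unfolding val_def
    by (intro bexI[of _ "u * w"]) (auto simp: power_int_add two_units_mult)
qed

lemma val_add:
  assumes "val x k" "val y l" "k < l"
  shows "val (x + y) k"
proof -
  from assms obtain u w where u: "u \<in> two_units" "x = 2 powi k * u" "w \<in> two_units" "y = 2 powi l * w"
    by (auto simp: val_def)
  obtain j where l: "l = k + 1 + int j" using assms(3) zle_iff_zadd[of "k + 1" l] by auto
  have "2 powi l = (2 powi k * (2 * 2 ^ j) :: real)" by (simp add: l power_int_add)
  then have "x + y = 2 powi k * (u + 2 * (of_int (2 ^ j) * w))" using u by (simp add: algebra_simps)
  moreover have "u + 2 * (of_int (2 ^ j) * w) \<in> two_units"
    by (intro two_units_add_even two_integers_mult_int two_units_subset u)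
  ultimately show ?thesis by (auto simp: val_def)
qed

lemma val_nonzero: "val x k \<Longrightarrow> x \<noteq> 0"
proof
  assume "val x k" "x = 0"
  then have "(0::real) \<in> two_units" by (auto simp: val_def)
  then show False using two_units_not_even[of 0] two_units_subset[of 0] by simp
qed

lemma val_odd: "odd m \<Longrightarrow> val (of_int m) 0"
  unfolding val_def two_units_def
  by (intro bexI[of _ "of_int m"] CollectI exI[of _ m] exI[of _ 0] exI[of _ 1]) auto

lemma val_two_power: "val (2 ^ k) (int k)"
  using val_odd[of 1] by (auto simp: val_def)

lemma power_of_two_times_odd:
  fixes m :: int
  assumes "m \<noteq> 0"
  shows "\<exists>e m'. m = 2 ^ e * m' \<and> odd m'"
proof -
  obtain m' where "m = 2 ^ multiplicity 2 m * m'" "odd m'"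
    by (rule multiplicity_decompose'[of m 2]) (use assms in simp_all)
  then show ?thesis by blast
qed

lemma val_exists:
  assumes "x \<in> K t" "x \<noteq> 0"
  shows "\<exists>k. val x k"
proof -
  from assms(1) obtain p q r where x: "x = p + q * \<theta> + r * \<theta>^2" "p \<in> \<rat>" "q \<in> \<rat>" "r \<in> \<rat>"
    unfolding K_eq by (metis cubic_spanE)
  obtain p1 p2 where p: "p = of_int p1 / of_int p2" "p2 > 0" using x(2) by (cases rule: Rats_cases') auto
  obtain q1 q2 where q: "q = of_int q1 / of_int q2" "q2 > 0" using x(3) by (cases rule: Rats_cases') auto
  obtain r1 r2 where r: "r = of_int r1 / of_int r2" "r2 > 0" using x(4) by (cases rule: Rats_cases') auto
  define m where "m = p2 * q2 * r2"
  define a b c where "a = p1 * q2 * r2" and "b = q1 * p2 * r2" and "c = r1 * p2 * q2"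
  have mx: "of_int m * x = of_int a + of_int b * \<theta> + of_int c * \<theta>^2"
    using p(2) q(2) r(2) unfolding x(1) p(1) q(1) r(1) m_def a_def b_def c_def
    by (simp add: field_simps)
  have m: "m \<noteq> 0" using p q r by (simp add: m_def)
  define h where "h = gcd a (gcd b c)"
  have h: "h \<noteq> 0"
  proof
    assume "h = 0"
    then have "a = 0 \<and> b = 0 \<and> c = 0" by (simp add: h_def)
    then show False using mx m assms(2) by simp
  qed
  obtain e m' where m': "m = 2 ^ e * m'" "odd m'" using power_of_two_times_odd[OF m] by blast
  obtain f h' where h': "h = 2 ^ f * h'" "odd h'" using power_of_two_times_odd[OF h] by blast
  have "2 ^ f dvd h" using h'(1) by simp
  then have dvd: "2 ^ f dvd a" "2 ^ f dvd b" "2 ^ f dvd c" by (auto simp: h_def)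
  then obtain a' b' c' where abc: "a = 2 ^ f * a'" "b = 2 ^ f * b'" "c = 2 ^ f * c'" by (auto elim!: dvdE)
  have "\<not> (even a' \<and> even b' \<and> even c')"
  proof
    assume "even a' \<and> even b' \<and> even c'"
    then have "2 ^ f * 2 dvd h" unfolding h_def abc by (auto intro!: gcd_greatest)
    then have "2 dvd h'" unfolding h'(1) by simp
    with h' show False by simp
  qed
  moreover have "of_int m' * (2 ^ e / 2 ^ f * x) = of_int a' + of_int b' * \<theta> + of_int c' * \<theta>^2"
    using mx unfolding m' abc by (simp add: field_simps)
  ultimately have "2 ^ e / 2 ^ f * x \<in> two_units"
    using m'(2) unfolding two_units_def by blast
  moreover have "x = 2 powi (int f - int e) * (2 ^ e / 2 ^ f * x)"
    by (simp add: power_int_diff)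
  ultimately show ?thesis unfolding val_def by blast
qed

text \<open>
  In the coordinate \<open>w = x / n\<close>, duplication on \<open>E n\<close> sends the abscissa \<open>w\<close> to
  \<open>(w\<^sup>2 + 1)\<^sup>2 / (4 * w * (w\<^sup>2 - 1))\<close>. This makes the valuation negative and from then on lowers
  it by 2 each time.
\<close>

lemma val_duplication:
  assumes d: "4 * w * (w^2 - 1) * z = (w^2 + 1)^2" and zK: "z \<in> K t"
    and w: "val w k" and n1: "val (w^2 + 1) l" and n2: "val (w^2 - 1) m"
  shows "val z (2 * l - 2 - k - m)"
proof -
  have "z \<noteq> 0" using d val_nonzero[OF n1] by auto
  then obtain j where j: "val z j" using val_exists zK by blast
  have "val (2 ^ 2 * w * (w^2 - 1) * z) (int 2 + k + m + j)"
    by (intro val_mult val_two_power w n2 j)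
  moreover have "val ((w^2 + 1) * (w^2 + 1)) (l + l)" by (intro val_mult n1)
  ultimately have "int 2 + k + m + j = l + l"
    using d by (intro val_unique) (auto simp: power2_eq_square)
  then have "j = 2 * l - 2 - k - m" by simp
  with j show ?thesis by simp
qed

lemma val_duplication_negative:
  assumes d: "4 * w * (w^2 - 1) * z = (w^2 + 1)^2" and zK: "z \<in> K t"
    and w: "val w k" and k: "k < 0"
  shows "val z (k - 2)"
proof -
  have w2: "val (w^2) (2 * k)" using val_mult[OF w w] by (simp add: power2_eq_square)
  have "val (w^2 + of_int 1) (2 * k)" "val (w^2 + of_int (- 1)) (2 * k)"
    using k by (intro val_add[OF w2 val_odd]; simp)+
  then show ?thesis using val_duplication[OF d zK w, of "2 * k" "2 * k"] by simp
qed

lemma val_duplication_becomes_negative: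
  assumes d: "4 * w * (w^2 - 1) * z = (w^2 + 1)^2" and zK: "z \<in> K t" and wK: "w \<in> K t"
    and nz: "w \<noteq> 0" "w^2 \<noteq> 1"
  shows "\<exists>k<0. val z k"
proof -
  obtain k where w: "val w k" using val_exists wK nz by blast
  have w2: "val (w^2) (2 * k)" using val_mult[OF w w] by (simp add: power2_eq_square)
  consider "k < 0" | "k > 0" | "k = 0" by linarith
  then show ?thesis
  proof cases
    case 1
    then show ?thesis using val_duplication_negative[OF d zK w] by (intro exI[of _ "k - 2"]) auto
  next
    case 2
    have "val (of_int 1 + w^2) 0" "val (of_int (- 1) + w^2) 0"
      using 2 by (intro val_add[OF val_odd w2]; simp)+
    then show ?thesis
      using val_duplication[OF d zK w, of 0 0] 2 by (intro exI[of _ "- 2 - k"]) (auto simp: add.commute)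
  next
    case 3
    have "w + 1 \<noteq> 0" "w - 1 \<noteq> 0" using nz by (auto simp: power2_eq_1_iff add_eq_0_iff2)
    moreover have "w + 1 \<in> K t" "w - 1 \<in> K t" using wK by (auto intro: K_closed)
    ultimately obtain i j where i: "val (w + 1) i" and j: "val (w - 1) j"
      using val_exists by blast
    have ij: "val (w^2 - 1) (i + j)"
      using val_mult[OF i j] by (simp add: power2_eq_square algebra_simps)
    have int: "w + of_int e \<in> two_integers" for e
    proof -
      have "w \<in> two_integers" "of_int 1 \<in> two_integers"
        using w val_odd[of 1] 3 by (auto simp: val_def two_units_subset)
      then show ?thesis using two_integers_add two_integers_mult_int[of 1 e] by force
    qed
    have i0: "i \<ge> 0" by (rule val_ge[OF i, of _ "w + 1"]) (use int[of 1] in auto)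
    show ?thesis
    proof (cases "i = 0")
      case True
      \<comment> \<open>\<open>w - 1 = (w + 1) - 2\<close> and \<open>w\<^sup>2 + 1 = (w + 1)\<^sup>2 - 2 w\<close> are units with \<open>w + 1\<close>.\<close>
      have v: "val (- 2) 1" "val (- 2 * w) 1"
        using val_mult[OF val_two_power[of 1] val_odd[of "- 1"]]
          val_mult[OF val_two_power[of 1] val_mult[OF val_odd[of "- 1"] w]] 3 by simp_all
      have "val (w + 1 + - 2) 0" by (rule val_add[OF i[unfolded True] v(1)]) simp
      moreover have "val ((w + 1) * (w + 1) + - 2 * w) 0"
        by (rule val_add[OF _ v(2)]) (use val_mult[OF i i] True in auto)
      ultimately have *: "val (w - 1) 0" "val (w^2 + 1) 0"
        by (simp_all add: power2_eq_square algebra_simps)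
      then have "j = 0" using val_unique j by blast
      then show ?thesis
        using val_duplication[OF d zK w *(2) ij] True 3 by (intro exI[of _ "-2"]) auto
    next
      case False
      have "j \<ge> 1"
      proof -
        from i obtain u where u: "u \<in> two_units" "w + 1 = 2 powi i * u" by (auto simp: val_def)
        obtain e where e: "i = 1 + int e" using False i0 zle_iff_zadd[of 1 i] by auto
        have "w - 1 = 2 powi 1 * (of_int (2 ^ e) * u + of_int (- 1))"
          using u(2) by (simp add: e power_int_add algebra_simps)
        moreover have "of_int (2 ^ e) * u + of_int (- 1) \<in> two_integers"
        proof (rule two_integers_add)
          show "of_int (2 ^ e) * u \<in> two_integers"
            by (rule two_integers_mult_int[OF two_units_subset[OF u(1)]])
          show "of_int (- 1) \<in> two_integers"
            using val_odd[of "- 1"] by (auto simp: val_def dest!: two_units_subset)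
        qed
        ultimately show ?thesis by (rule val_ge[OF j])
      qed
      \<comment> \<open>Now \<open>w\<^sup>2 - 1\<close> is divisible by 4, so \<open>w\<^sup>2 + 1\<close> is exactly divisible by 2.\<close>
      then have "val (2 ^ 1 + (w^2 - 1)) (int 1)"
        using False i0 by (intro val_add[OF val_two_power ij]) auto
      then have "val (w^2 + 1) 1" by (simp add: algebra_simps)
      from val_duplication[OF d zK w this ij] show ?thesis
        using 3 \<open>j \<ge> 1\<close> i0 False by (intro exI[of _ "- (i + j)"]) auto
    qed
  qed
qed


end

lemma nonsingular_E: "n > 0 \<Longrightarrow> nonsingular (- (real_of_int n ^ 2)) 0"
proof -
  assume n: "n > 0"
  have False if "x^3 + - (real_of_int n ^ 2) * x + 0 = 0" "3 * x^2 + - (real_of_int n ^ 2) = 0" for x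
  proof -
    have "2 * x^3 = x * (3 * x^2 + - (real_of_int n ^ 2)) - (x^3 + - (real_of_int n ^ 2) * x + 0)"
      by Groebner_Basis.algebra
    also have "\<dots> = 0" unfolding that by simp
    finally have "x = 0" by simp
    then show False using that n by simp
  qed
  then show ?thesis by (auto simp: nonsingular_def)
qed

lemma comm_group_E:
  assumes "n > 0" "subfield F ring_of_type_algebra"
  shows "comm_group (E n F)"
  unfolding E_def
  by (rule comm_group_ec_group[OF assms(2) _ nonsingular_E[OF assms(1)]])
    (intro subfield_type_algebraD[OF assms(2)])

lemma E_simps [simp]:
  "monoid.mult (E n F) = ec_add (- (of_int n ^ 2))" "\<one>\<^bsub>E n F\<^esub> = Infinity"
  "Infinity \<in> carrier (E n F)"
  "Affine x y \<in> carrier (E n F) \<longleftrightarrow> x \<in> F \<and> y \<in> F \<and> y^2 = x^3 - of_int n ^ 2 * x"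
  by (auto simp: E_def)

lemma ec_add_double:
  fixes x y :: real
  assumes "y \<noteq> 0" and on: "y^2 = x^3 - of_int n ^ 2 * x"
  obtains z v where "ec_add (- (of_int n ^ 2)) (Affine x y) (Affine x y) = Affine z v"
    "4 * x * (x^2 - of_int n ^ 2) * z = (x^2 + of_int n ^ 2)^2"
proof -
  define l where "l = (3 * x^2 - of_int n ^ 2) / (2 * y)"
  have "ec_add (- (of_int n ^ 2)) (Affine x y) (Affine x y) = Affine (l^2 - x - x) (l * (x - (l^2 - x - x)) - y)"
    using assms by (simp add: ec_add.simps(3) l_def Let_def)
  moreover have "l * (2 * y) = 3 * x^2 - of_int n ^ 2" using assms by (simp add: l_def)
  then have "4 * x * (x^2 - of_int n ^ 2) * (l^2 - x - x) = (x^2 + of_int n ^ 2)^2"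
    using on by Groebner_Basis.algebra
  ultimately show thesis using that by blast
qed

context simplest_cubic
begin

context
  fixes n :: int
  assumes n: "n > 0"
begin

interpretation EK: comm_group "E n (K t)"
  by (rule comm_group_E[OF n subfield_K])

lemma double_in_E:
  assumes P: "Affine x y \<in> carrier (E n (K t))" and y: "y \<noteq> 0"
  obtains z v where "Affine x y \<otimes>\<^bsub>E n (K t)\<^esub> Affine x y = Affine z v"
    "Affine z v \<in> carrier (E n (K t))" "x / of_int n \<in> K t" "z / of_int n \<in> K t"
    "x / of_int n \<noteq> 0" "(x / of_int n)^2 \<noteq> 1"
    "4 * (x / of_int n) * ((x / of_int n)^2 - 1) * (z / of_int n) = ((x / of_int n)^2 + 1)^2"
proof -
  from P have on: "x \<in> K t" "y^2 = x^3 - of_int n ^ 2 * x" by auto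
  obtain z v where add: "ec_add (- (of_int n ^ 2)) (Affine x y) (Affine x y) = Affine z v"
    and z: "4 * x * (x^2 - of_int n ^ 2) * z = (x^2 + of_int n ^ 2)^2"
    using ec_add_double[OF y on(2)] .
  have zv: "Affine z v \<in> carrier (E n (K t))" using EK.m_closed[OF P P] add by simp
  have "y^2 = x * (x^2 - of_int n ^ 2)" using on(2) by Groebner_Basis.algebra
  then have "x \<noteq> 0" "x^2 \<noteq> of_int n ^ 2" using y by auto
  then have "x / of_int n \<noteq> 0" "(x / of_int n)^2 \<noteq> 1" using n by (auto simp: power_divide)
  moreover have "4 * (x / of_int n) * ((x / of_int n)^2 - 1) * (z / of_int n) = ((x / of_int n)^2 + 1)^2"
  proof -
    have "of_int n ^ 4 * (4 * (x / of_int n) * ((x / of_int n)^2 - 1) * (z / of_int n))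
        = 4 * x * (x^2 - of_int n ^ 2) * z"
      using n by (simp add: field_simps power2_eq_square power4_eq_xxxx)
    also have "\<dots> = of_int n ^ 4 * ((x / of_int n)^2 + 1)^2"
      unfolding z using n by (simp add: field_simps power2_eq_square power4_eq_xxxx)
    finally show ?thesis
      by (rule mult_left_cancel[THEN iffD1, rotated]) (use n in simp)
  qed
  moreover have "x / of_int n \<in> K t" "z / of_int n \<in> K t"
    using on(1) zv K_closed(8,11) by auto
  moreover have "Affine x y \<otimes>\<^bsub>E n (K t)\<^esub> Affine x y = Affine z v" using add by simp
  ultimately show thesis using that[OF _ zv] by blast
qed

text \<open>
  The powers of two multiply a point with \<open>y \<noteq> 0\<close> to infinitely many points, because the valuation
  of the abscissa tends to minus infinity.
\<close>

lemma infinite_order_E: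
  assumes P: "Affine x y \<in> carrier (E n (K t))" and y: "y \<noteq> 0"
  shows "infinite_order (E n (K t)) (Affine x y)"
proof -
  let ?G = "E n (K t)" and ?P = "Affine x y"
  define D where "D j = ?P [^]\<^bsub>?G\<^esub> (2 ^ j :: nat)" for j
  have D_closed: "D j \<in> carrier ?G" for j using P by (simp add: D_def del: E_simps)
  have D_Suc: "D (Suc j) = D j \<otimes>\<^bsub>?G\<^esub> D j" for j
    unfolding D_def using EK.nat_pow_mult[OF P, of "2 ^ j" "2 ^ j"] by (simp add: mult_2 del: E_simps)
  have D0: "D 0 = ?P" unfolding D_def using EK.nat_pow_eone[OF P] by (simp del: E_simps)
  have "D (Suc 0) = ?P \<otimes>\<^bsub>?G\<^esub> ?P" by (simp add: D_Suc D0 del: E_simps)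
  then obtain k z v where k: "k < 0" "val (z / of_int n) k" "D (Suc 0) = Affine z v"
    by (metis double_in_E[OF P y] val_duplication_becomes_negative)
  have step: "\<exists>z v. D (Suc j) = Affine z v \<and> val (z / of_int n) (k - 2 * int j)" for j
  proof (induction j)
    case (Suc j)
    then obtain z v where z: "D (Suc j) = Affine z v" "val (z / of_int n) (k - 2 * int j)" by blast
    have on: "Affine z v \<in> carrier ?G" using D_closed[of "Suc j"] z by simp
    have "v \<noteq> 0"
    proof
      assume "v = 0"
      then have "z^3 - of_int n ^ 2 * z = 0" using on by simp
      then have "z * (z^2 - of_int n ^ 2) = 0" by Groebner_Basis.algebra
      then have "z / of_int n = 0 \<or> (z / of_int n)^2 = 1" using n by (auto simp: power_divide)
      then have "z / of_int n = 0 \<or> z / of_int n = of_int 1 \<or> z / of_int n = of_int (- 1)"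
        by (simp add: power2_eq_1_iff)
      then have "k - 2 * int j = 0"
        using val_nonzero[OF z(2)] val_unique[OF z(2)] val_odd[of 1] val_odd[of "- 1"] by fastforce
      then show False using k by simp
    qed
    from double_in_E[OF on this] obtain z' v' where "D (Suc (Suc j)) = Affine z' v'"
      "z' / of_int n \<in> K t"
      "4 * (z / of_int n) * ((z / of_int n)^2 - 1) * (z' / of_int n) = ((z / of_int n)^2 + 1)^2"
      using D_Suc[of "Suc j"] z(1) by metis
    moreover from this(3,2) have "val (z' / of_int n) (k - 2 * int j - 2)"
      by (rule val_duplication_negative[OF _ _ z(2)]) (use k in simp)
    moreover have "k - 2 * int j - 2 = k - 2 * int (Suc j)" by simp
    ultimately show ?case by metis
  qed (use k in auto)
  have inj: "inj (\<lambda>j. D (Suc j))"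
  proof (rule injI)
    fix i j assume "D (Suc i) = D (Suc j)"
    with step[of i] step[of j] have "k - 2 * int i = k - 2 * int j"
      using val_unique by (metis ec_point.inject)
    then show "i = j" by simp
  qed
  show ?thesis unfolding infinite_order_def
  proof (intro allI impI notI)
    fix m :: nat assume m: "m > 0" "?P [^]\<^bsub>?G\<^esub> m = \<one>\<^bsub>?G\<^esub>"
    have "?P [^]\<^bsub>?G\<^esub> i = ?P [^]\<^bsub>?G\<^esub> (i mod m)" for i :: nat
    proof -
      have "?P [^]\<^bsub>?G\<^esub> i = ?P [^]\<^bsub>?G\<^esub> (m * (i div m)) \<otimes>\<^bsub>?G\<^esub> ?P [^]\<^bsub>?G\<^esub> (i mod m)"
        by (subst EK.nat_pow_mult[OF P]) simp
      also have "?P [^]\<^bsub>?G\<^esub> (m * (i div m)) = \<one>\<^bsub>?G\<^esub>"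
        unfolding EK.nat_pow_pow[OF P, symmetric] m(2) by (rule EK.nat_pow_one)
      finally show ?thesis using EK.nat_pow_closed[OF P] by (metis EK.l_one)
    qed
    then have "range (\<lambda>j. D (Suc j)) \<subseteq> (\<lambda>i. ?P [^]\<^bsub>?G\<^esub> i) ` {..<m}"
      unfolding D_def using m(1) by (metis (no_types, lifting) image_subsetI imageI lessThan_iff mod_less_divisor)
    then have "finite (range (\<lambda>j. D (Suc j)))" by (rule finite_subset) simp
    with inj show False using range_inj_infinite by blast
  qed
qed

end

end

section \<open>Ranks of abelian groups\<close>

lemma (in group) int_pow_eq_one_infinite_order:
  assumes "x \<in> carrier G" "infinite_order G x" "x [^] (z::int) = \<one>"
  shows "z = 0"
proof (rule ccontr)
  assume "z \<noteq> 0"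
  have "x [^] nat \<bar>z\<bar> = \<one>"
  proof (cases "z < 0")
    case True
    then have "x [^] z = inv (x [^] nat \<bar>z\<bar>)"
      using int_pow_neg_int[OF assms(1), of "nat \<bar>z\<bar>"] by simp
    then show ?thesis using assms by (metis inv_inv inv_one nat_pow_closed)
  next
    case False
    then have "x [^] z = x [^] nat \<bar>z\<bar>" using int_pow_int[of G x "nat \<bar>z\<bar>"] by simp
    then show ?thesis using assms by simp
  qed
  then show False using assms(2) \<open>z \<noteq> 0\<close> unfolding infinite_order_def
    by (metis zero_less_abs_iff zero_less_nat_eq)
qed

lemma (in comm_group) abelian_rank_zero_torsion:
  assumes rank: "abelian_rank G = 0" and x: "x \<in> carrier G"
  shows "\<not> infinite_order G x"
proof
  assume inf: "infinite_order G x"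
  have "int_independent G {x}"
    unfolding int_independent_def using x int_pow_eq_one_infinite_order[OF x inf] by auto
  then have "enat (card {x}) \<le> abelian_rank G"
    unfolding abelian_rank_def by (intro SUP_upper) simp
  then show False using rank by (simp add: zero_enat_def)
qed

lemma exists_orthogonal_int3:
  fixes a1 a2 a3 b1 b2 b3 :: int
  obtains c1 c2 c3 where "(c1, c2, c3) \<noteq> (0, 0, 0)"
    "c1 * a1 + c2 * a2 + c3 * a3 = 0" "c1 * b1 + c2 * b2 + c3 * b3 = 0"
proof -
  \<comment> \<open>The cross product, unless the two vectors are proportional.\<close>
  consider "(a2 * b3 - a3 * b2, a3 * b1 - a1 * b3, a1 * b2 - a2 * b1) \<noteq> (0, 0, 0)"
    | "a1 * b2 = a2 * b1" "a1 \<noteq> 0" | "a1 * b2 = a2 * b1" "b1 \<noteq> 0" | "a1 = 0" "b1 = 0" by force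
  then show thesis
  proof cases
    case 1
    then show thesis by (rule that) (simp_all add: algebra_simps)
  next
    case 2
    then show thesis by (intro that[of a2 "- a1" 0]) (auto simp: algebra_simps)
  next
    case 3
    then show thesis by (intro that[of b2 "- b1" 0]) (auto simp: algebra_simps)
  next
    case 4
    then show thesis by (intro that[of 1 0 0]) auto
  qed
qed

lemma (in comm_group) abelian_rank_eq_2:
  assumes P: "P \<in> carrier G" and Q: "Q \<in> carrier G"
    and indep: "\<And>(m :: int) (k :: int). P [^] m \<otimes> Q [^] k = \<one> \<Longrightarrow> m = 0 \<and> k = 0"
    and gen: "\<And>x. x \<in> carrier G \<Longrightarrow> \<exists>(a :: int) (b :: int). x = P [^] a \<otimes> Q [^] b"
  shows "abelian_rank G = 2"
proof (rule antisym)
  have "P \<noteq> Q"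
  proof
    assume "P = Q"
    then have "P [^] (1::int) \<otimes> Q [^] (- 1 :: int) = \<one>" using Q by (simp add: int_pow_neg)
    from indep[OF this] show False by simp
  qed
  then have card: "card {P, Q} = 2" by simp
  have "(\<Otimes>s\<in>{P, Q}. s [^] c s) = P [^] c P \<otimes> Q [^] c Q" for c :: "'a \<Rightarrow> int"
    using P Q \<open>P \<noteq> Q\<close> by simp
  then have "int_independent G {P, Q}"
    unfolding int_independent_def using P Q indep by fastforce
  then have "enat (card {P, Q}) \<le> abelian_rank G"
    unfolding abelian_rank_def by (intro SUP_upper) simp
  then show "2 \<le> abelian_rank G" unfolding card by (simp add: numeral_eq_enat)
  show "abelian_rank G \<le> 2" unfolding abelian_rank_def
  proof (rule SUP_least)
    fix S assume "S \<in> {S. int_independent G S}"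
    then have S: "finite S" "S \<subseteq> carrier G"
      "\<And>c :: 'a \<Rightarrow> int. (\<Otimes>s\<in>S. s [^] c s) = \<one> \<Longrightarrow> \<forall>s\<in>S. c s = 0"
      by (auto simp: int_independent_def)
    have "card S \<le> 2"
    proof (rule ccontr)
      assume "\<not> card S \<le> 2"
      then obtain T where "T \<subseteq> S" "card T = 3" by (metis not_less_eq_eq numeral_2_eq_2 numeral_3_eq_3 obtain_subset_with_card_n)
      then obtain u v w where T: "u \<in> S" "v \<in> S" "w \<in> S" and ne: "u \<noteq> v" "u \<noteq> w" "v \<noteq> w"
        by (auto simp: card_3_iff)
      have c: "u \<in> carrier G" "v \<in> carrier G" "w \<in> carrier G" using T S(2) by auto
      obtain a1 b1 a2 b2 a3 b3 :: int where
        uvw: "u = P [^] a1 \<otimes> Q [^] b1" "v = P [^] a2 \<otimes> Q [^] b2" "w = P [^] a3 \<otimes> Q [^] b3"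
        using gen c by metis
      obtain c1 c2 c3 where c123: "(c1, c2, c3) \<noteq> (0, 0, 0)"
        "c1 * a1 + c2 * a2 + c3 * a3 = 0" "c1 * b1 + c2 * b2 + c3 * b3 = 0"
        by (rule exists_orthogonal_int3)
      define f where "f = (\<lambda>s. if s = u then c1 else if s = v then c2 else if s = w then c3 else 0)"
      have pw: "(P [^] a \<otimes> Q [^] b) [^] e = P [^] (e * a) \<otimes> Q [^] (e * b)" for a b e :: int
        using P Q by (simp add: int_pow_distrib int_pow_pow mult.commute)
      have "(\<Otimes>s\<in>S. s [^] f s) = (\<Otimes>s\<in>insert u (insert v (insert w (S - {u, v, w}))). s [^] f s)"
        by (rule arg_cong[where f = "finprod G (\<lambda>s. s [^] f s)"]) (use T in auto)
      also have "\<dots> = u [^] c1 \<otimes> (v [^] c2 \<otimes> (w [^] c3 \<otimes> (\<Otimes>s\<in>S - {u, v, w}. s [^] f s)))"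
        using S(1,2) c ne by (subst finprod_insert, force, force, force, force)+ (auto simp: f_def)
      also have "(\<Otimes>s\<in>S - {u, v, w}. s [^] f s) = \<one>"
        by (rule finprod_one_eqI) (auto simp: f_def)
      also have "u [^] c1 \<otimes> (v [^] c2 \<otimes> (w [^] c3 \<otimes> \<one>))
          = P [^] (c1 * a1 + c2 * a2 + c3 * a3) \<otimes> Q [^] (c1 * b1 + c2 * b2 + c3 * b3)"
        unfolding uvw pw using P Q by (simp add: int_pow_mult m_ac)
      also have "\<dots> = \<one>" by (simp add: c123)
      finally have "\<forall>s\<in>S. f s = 0" by (rule S(3))
      then have "f u = 0" "f v = 0" "f w = 0" using T by auto
      then show False using c123(1) ne by (auto simp: f_def)
    qed
    then show "enat (card S) \<le> 2" by (simp add: numeral_eq_enat)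
  qed
qed

text \<open>
  If \<open>s\<close> is an endomorphism with \<open>P + s P + s (s P) = 0\<close>, then a relation \<open>m P + k (s P) = 0\<close>
  together with its image under \<open>s\<close> yields \<open>(m\<^sup>2 - m k + k\<^sup>2) P = 0\<close>.
\<close>

lemma (in comm_group) trace_zero_rank_two:
  assumes s: "s \<in> hom G G" and P: "P \<in> carrier G" and inf: "infinite_order G P"
    and tr: "P \<otimes> s P \<otimes> s (s P) = \<one>"
  shows "abelian_rank (subgroup_generated G {P, s P, s (s P)}) = 2"
proof -
  interpret s: group_hom G G s by unfold_locales (rule s)
  define Q R where "Q = s P" and "R = s (s P)"
  have c: "Q \<in> carrier G" "R \<in> carrier G" using P by (auto simp: Q_def R_def)
  have R: "R = P [^] (- 1 :: int) \<otimes> Q [^] (- 1 :: int)"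
  proof -
    have "R \<otimes> (P \<otimes> Q) = \<one>" using tr P c by (simp add: Q_def R_def m_comm)
    then have "R = inv (P \<otimes> Q)" using P c by (metis inv_equality m_closed)
    then show ?thesis using P c by (simp add: inv_mult int_pow_neg)
  qed
  have indep: "m = 0 \<and> k = 0" if eq: "P [^] m \<otimes> Q [^] k = \<one>" for m k :: int
  proof -
    have "s (P [^] m \<otimes> Q [^] k) = Q [^] m \<otimes> R [^] k"
      using P c s by (simp add: Q_def R_def s.hom_int_pow)
    then have "Q [^] m \<otimes> R [^] k = \<one>" unfolding eq by simp
    also have "Q [^] m \<otimes> R [^] k = P [^] (- k) \<otimes> Q [^] (m - k)"
    proof -
      have "R [^] k = P [^] (- k) \<otimes> Q [^] (- k)"
        unfolding R using P c by (simp add: int_pow_distrib int_pow_pow)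
      moreover have "Q [^] (m - k) = Q [^] m \<otimes> Q [^] (- k)"
        using c by (simp flip: int_pow_mult)
      ultimately show ?thesis using P c by (simp add: m_ac)
    qed
    finally have eq2: "P [^] (- k) \<otimes> Q [^] (m - k) = \<one>" .
    have pw: "(P [^] a \<otimes> Q [^] b) [^] e = P [^] (a * e) \<otimes> Q [^] (b * e)" for a b e :: int
      using P c by (simp add: int_pow_distrib int_pow_pow)
    have 1: "P [^] (m * (m - k)) \<otimes> Q [^] (k * (m - k)) = \<one>"
      using pw[of m k "m - k"] unfolding eq by simp
    have 2: "P [^] (- k * k) \<otimes> Q [^] (k * (m - k)) = \<one>"
      using pw[of "- k" "m - k" k] unfolding eq2 by (simp add: mult.commute)
    from 1 2 have "P [^] (m * (m - k)) = P [^] (- k * k)"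
      using P c by (metis int_pow_closed r_cancel)
    then have "P [^] (m * (m - k) - (- k * k)) = \<one>"
      by (metis int_pow_diff[OF P] r_inv int_pow_closed[OF P])
    then have "m * (m - k) - (- k * k) = 0" by (rule int_pow_eq_one_infinite_order[OF P inf])
    then have "(2 * m - k)^2 + 3 * k^2 = 0" by Groebner_Basis.algebra
    moreover have "(2 * m - k)^2 \<ge> 0" "k^2 \<ge> 0" by simp_all
    ultimately have "(2 * m - k)^2 = 0" "k^2 = 0" by linarith+
    then show ?thesis by simp
  qed
  let ?H = "subgroup_generated G {P, Q, R}"
  interpret H: comm_group ?H
    by (rule abelian_subgroup_generated) (rule comm_group_axioms)
  have sub: "{P, Q, R} \<subseteq> carrier ?H"
    by (rule subgroup_generated_subset_carrier_subset) (use P c in auto)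
  have gen: "\<exists>(a :: int) (b :: int). x = P [^] a \<otimes> Q [^] b" if "x \<in> carrier ?H" for x
  proof -
    have "carrier G \<inter> {P, Q, R} = {P, Q, R}" using P c by auto
    then have "x \<in> generate G {P, Q, R}" using that by (simp add: carrier_subgroup_generated)
    then show ?thesis
    proof (induction rule: generate.induct)
      case one
      show ?case by (intro exI[of _ 0]) simp
    next
      case (incl h)
      have "P = P [^] (1::int) \<otimes> Q [^] (0::int)" "Q = P [^] (0::int) \<otimes> Q [^] (1::int)"
        using P c by simp_all
      with incl R show ?case by (metis empty_iff insert_iff)
    next
      case (inv h)
      have "inv P = P [^] (- 1::int) \<otimes> Q [^] (0::int)" "inv Q = P [^] (0::int) \<otimes> Q [^] (- 1::int)"
        "inv R = P [^] (1::int) \<otimes> Q [^] (1::int)"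
        unfolding R using P c by (simp_all add: int_pow_neg inv_mult)
      with inv show ?case by (metis empty_iff insert_iff)
    next
      case (eng h1 h2)
      then obtain a b a' b' :: int where "h1 = P [^] a \<otimes> Q [^] b" "h2 = P [^] a' \<otimes> Q [^] b'" by blast
      then have "h1 \<otimes> h2 = P [^] (a + a') \<otimes> Q [^] (b + b')"
        using P c by (simp add: int_pow_mult m_ac)
      then show ?case by blast
    qed
  qed
  have pow: "x [^]\<^bsub>?H\<^esub> (k::int) = x [^] k" if "x \<in> {P, Q, R}" for x k
    using int_pow_subgroup_generated that sub by blast
  have "abelian_rank ?H = 2"
    by (rule H.abelian_rank_eq_2[of P Q]) (use sub indep gen in \<open>auto simp: pow\<close>)
  then show ?thesis by (simp add: Q_def R_def)
qed

section \<open>Points of trace zero\<close>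

lemma nat_pow_E: "P [^]\<^bsub>E n F\<^esub> (m::nat) = P [^]\<^bsub>E n F'\<^esub> m"
  by (induction m) auto

context simplest_cubic
begin

context
  fixes n :: int
  assumes n: "n > 0"
begin

interpretation EK: comm_group "E n (K t)"
  by (rule comm_group_E[OF n subfield_K])

lemma sigma_diff: "x \<in> K t \<Longrightarrow> y \<in> K t \<Longrightarrow> sigma t (x - y) = sigma t x - sigma t y"
  using sigma_add[of "x - y" y] K_closed(5) by simp

lemma sigma_power: "x \<in> K t \<Longrightarrow> sigma t (x ^ k) = sigma t x ^ k"
  by (induction k) (auto simp: sigma_Rats sigma_mult K_closed)

lemma conj_point_hom: "conj_point t \<in> hom (E n (K t)) (E n (K t))"
proof (rule homI)
  fix P assume P: "P \<in> carrier (E n (K t))"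
  show "conj_point t P \<in> carrier (E n (K t))"
  proof (cases P)
    case (Affine x y)
    then have xy: "x \<in> K t" "y \<in> K t" "y^2 = x^3 - of_int n ^ 2 * x" using P by auto
    have "sigma t (y^2) = sigma t (x^3 - of_int n ^ 2 * x)" by (simp add: xy)
    also have "\<dots> = sigma t x ^ 3 - of_int n ^ 2 * sigma t x"
      using xy K_closed by (simp add: sigma_diff sigma_mult sigma_power sigma_Rats)
    finally have "sigma t y ^ 2 = sigma t x ^ 3 - of_int n ^ 2 * sigma t x"
      unfolding sigma_power[OF xy(2)] .
    then show ?thesis using xy Affine by (simp add: sigma_closed)
  qed simp
  fix Q assume Q: "Q \<in> carrier (E n (K t))"
  show "conj_point t (P \<otimes>\<^bsub>E n (K t)\<^esub> Q) = conj_point t P \<otimes>\<^bsub>E n (K t)\<^esub> conj_point t Q"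
    unfolding E_simps
    by (rule map_ec_add[OF subfield_K])
      (use P Q in \<open>auto simp: E_def sigma_Rats sigma_add sigma_mult sigma_inj intro!: K_closed\<close>)
qed

lemma conj_point_closed: "P \<in> carrier (E n (K t)) \<Longrightarrow> conj_point t P \<in> carrier (E n (K t))"
  using hom_in_carrier[OF conj_point_hom] .

lemma conj_point_order_three:
  "P \<in> carrier (E n (K t)) \<Longrightarrow> conj_point t (conj_point t (conj_point t P)) = P"
  by (cases P) (auto simp: sigma_sigma_sigma)

lemma Tr_closed: "P \<in> carrier (E n (K t)) \<Longrightarrow> Tr n t P \<in> carrier (E n (K t))"
  unfolding Tr_def by (intro EK.m_closed conj_point_closed)

lemma conj_point_Tr:
  assumes P: "P \<in> carrier (E n (K t))"
  shows "conj_point t (Tr n t P) = Tr n t P"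
proof -
  note c = conj_point_closed
  have "conj_point t (Tr n t P) = conj_point t P \<otimes>\<^bsub>E n (K t)\<^esub> conj_point t (conj_point t P) \<otimes>\<^bsub>E n (K t)\<^esub> P"
    unfolding Tr_def
    using hom_mult[OF conj_point_hom] P c EK.m_closed by (metis conj_point_order_three)
  also have "\<dots> = Tr n t P" unfolding Tr_def using P c EK.m_closed EK.m_comm EK.m_assoc by metis
  finally show ?thesis .
qed

lemma conj_point_fixed:
  assumes "P \<in> carrier (E n (K t))" "conj_point t P = P"
  shows "P \<in> carrier (E n \<rat>)"
  using assms sigma_fixed by (cases P) auto

lemma Tr_mult_fixed:
  assumes P: "P \<in> carrier (E n (K t))" and T: "T \<in> carrier (E n (K t))" "conj_point t T = T"
  shows "Tr n t (P \<otimes>\<^bsub>E n (K t)\<^esub> T)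
    = Tr n t P \<otimes>\<^bsub>E n (K t)\<^esub> (T \<otimes>\<^bsub>E n (K t)\<^esub> T \<otimes>\<^bsub>E n (K t)\<^esub> T)"
proof -
  note c = conj_point_closed
  have 1: "conj_point t (P \<otimes>\<^bsub>E n (K t)\<^esub> T) = conj_point t P \<otimes>\<^bsub>E n (K t)\<^esub> T"
    using hom_mult[OF conj_point_hom P T(1)] T(2) by simp
  have 2: "conj_point t (conj_point t P \<otimes>\<^bsub>E n (K t)\<^esub> T) = conj_point t (conj_point t P) \<otimes>\<^bsub>E n (K t)\<^esub> T"
    using hom_mult[OF conj_point_hom c[OF P] T(1)] T(2) by simp
  show ?thesis
    unfolding Tr_def 1 2 using P T(1) c EK.m_closed by (simp add: EK.m_ac del: E_simps)
qed

text \<open>Rank zero of \<open>E n\<close> over the rationals leaves only the points of order at most 2.\<close>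

lemma rank_zero_E_Rats:
  assumes rank: "abelian_rank (E n \<rat>) = 0" and T: "T \<in> carrier (E n \<rat>)"
  shows "T = Infinity \<or> (\<exists>e\<in>{0, n, - n}. T = Affine (of_int e) 0)"
proof (cases T)
  case (Affine x y)
  interpret EQ: comm_group "E n \<rat>" by (rule comm_group_E[OF n subfield_Rats])
  have T': "Affine x y \<in> carrier (E n (K t))" using T Rats_subset_K unfolding Affine by auto
  have "\<not> infinite_order (E n \<rat>) T" by (rule EQ.abelian_rank_zero_torsion[OF rank T])
  then have "\<not> infinite_order (E n (K t)) T"
    unfolding infinite_order_def E_simps using nat_pow_E by metis
  then have y: "y = 0" using infinite_order_E[OF n T'] Affine by auto
  then have "x^3 - of_int n ^ 2 * x = 0" using T' by simp
  then have "x * (x - of_int n) * (x + of_int n) = 0" by Groebner_Basis.algebra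
  then have "x = of_int 0 \<or> x = of_int n \<or> x = of_int (- n)" by (auto simp: add_eq_0_iff2)
  then show ?thesis using Affine y by auto
qed simp

text \<open>
  A point of trace zero with irrational abscissa lies with its conjugates on a line, which is
  stable under conjugation and hence defined over the rationals.
\<close>

lemma trace_zero_line:
  assumes P: "Affine x y \<in> carrier (E n (K t))" and irr: "x \<notin> \<rat>"
    and tr: "Tr n t (Affine x y) = Infinity"
  shows "\<exists>a\<in>\<rat>. \<exists>b\<in>\<rat>. \<forall>z.
    z^3 - of_int n ^ 2 * z - (a * z + b)^2 = (z - x) * (z - sigma t x) * (z - sigma t (sigma t x))"
proof -
  define x2 y2 x3 y3 where "x2 = sigma t x" and "y2 = sigma t y" and "x3 = sigma t x2" and "y3 = sigma t y2"
  note defs = x2_def y2_def x3_def y3_def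
  have K: "x \<in> K t" "y \<in> K t" "x2 \<in> K t" "y2 \<in> K t" "x3 \<in> K t" "y3 \<in> K t"
    using P by (auto simp: defs sigma_closed)
  have P2: "Affine x2 y2 \<in> carrier (E n (K t))" and P3: "Affine x3 y3 \<in> carrier (E n (K t))"
    using conj_point_closed[OF P] conj_point_closed[OF conj_point_closed[OF P]]
    by (simp_all add: defs del: E_simps)
  have ne: "x2 \<noteq> x" using sigma_fixed[OF K(1)] irr by (auto simp: x2_def)
  have ne': "x3 \<noteq> x2" using ne inj_onD[OF sigma_inj _ K(3) K(1)] by (auto simp: x2_def x3_def)
  let ?a = "- (real_of_int n ^ 2)"
  have "ec_add ?a (ec_add ?a (Affine x y) (Affine x2 y2)) (Affine x3 y3) = Infinity"
    using tr by (simp add: Tr_def defs)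
  then have neg: "ec_add ?a (Affine x y) (Affine x2 y2) = Affine x3 (- y3)"
    unfolding ec_add_eq_Infinity_iff by (metis ec_neg.simps(2) ec_neg_neg)
  have c: "y^2 = x^3 + ?a * x + 0" "y2^2 = x2^3 + ?a * x2 + 0" using P P2 by auto
  from ne obtain l where l: "is_slope ?a x y x2 y2 l"
    and "ec_add ?a (Affine x y) (Affine x2 y2) = Affine (l^2 - x - x2) (l * (x - (l^2 - x - x2)) - y)"
    by (auto intro: ec_add_affine[OF c])
  with neg have x3: "x3 = l^2 - x - x2" and y3: "- y3 = l * (x - x3) - y" by auto
  have l': "l * (x2 - x) = y2 - y" using l by (simp add: is_slope_def)
  have lK: "l \<in> K t"
  proof -
    have "l = (y2 - y) / (x2 - x)" using l' ne by (simp add: field_simps)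
    then show ?thesis using K by (auto intro: K_closed(5,8))
  qed
  have "sigma t (l * (x2 - x)) = sigma t l * (x3 - x2)"
    using lK K by (simp add: sigma_mult sigma_diff K_closed defs)
  moreover have "sigma t (l * (x2 - x)) = y3 - y2"
    unfolding l' using K by (simp add: sigma_diff defs)
  moreover have "l * (x3 - x2) = y3 - y2" using y3 l' by Groebner_Basis.algebra
  ultimately have sl: "sigma t l = l" using ne' by simp
  have "sigma t (y - l * x) = y2 - l * x2"
    using lK K sl by (simp add: sigma_mult sigma_diff K_closed defs)
  moreover have "y2 - l * x2 = y - l * x" using l' by Groebner_Basis.algebra
  ultimately have b: "y - l * x \<in> \<rat>" using lK K by (intro sigma_fixed K_closed) auto
  have "z^3 - of_int n ^ 2 * z - (l * z + (y - l * x))^2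
      = (z - x) * (z - sigma t x) * (z - sigma t (sigma t x))" for z
    using l x3 c(1) unfolding x2_def[symmetric] x3_def[symmetric] is_slope_def
    by Groebner_Basis.algebra
  then show ?thesis using sigma_fixed[OF lK sl] b by blast
qed

text \<open>The minimal polynomial of \<open>\<theta> - 1\<close>.\<close>

lemma conj_product:
  "(z - (\<theta> - 1)) * (z - sigma t (\<theta> - 1)) * (z - sigma t (sigma t (\<theta> - 1)))
    = z^3 + (3 - of_int t) * z^2 - 3 * of_int t * z - (2 * of_int t + 3)"
proof -
  have r: "rho \<theta> \<in> K t" using rho_in_cubic_span[OF root] by (simp add: K_eq)
  have "sigma t (rho \<theta>) = rho (rho \<theta>)"
  proof -
    have "sigma t (rho \<theta> * (\<theta> + 1)) = sigma t (rho \<theta>) * (rho \<theta> + 1)"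
      using r theta_in_K by (simp add: sigma_mult sigma_add sigma_Rats sigma_theta K_closed)
    moreover have "rho \<theta> * (\<theta> + 1) = - 1" using root_nonzero[OF root] by (simp add: rho_def)
    ultimately have "sigma t (rho \<theta>) * (rho \<theta> + 1) = - 1" by (simp add: sigma_Rats)
    then show ?thesis
      using root_nonzero[OF rho_eq(4)[OF root]] by (simp add: rho_def[of "rho \<theta>"] field_simps)
  qed
  then have s: "sigma t (\<theta> - 1) = rho \<theta> - 1" "sigma t (sigma t (\<theta> - 1)) = rho (rho \<theta>) - 1"
    using r theta_in_K by (simp_all add: sigma_diff sigma_theta sigma_Rats K_closed)
  have "(z - (\<theta> - 1)) * (z - (u - 1)) * (z - (w - 1))
      = (z + 1)^3 - (\<theta> + u + w) * (z + 1)^2 + (\<theta> * u + \<theta> * w + u * w) * (z + 1) - \<theta> * u * w"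
    for u w by Groebner_Basis.algebra
  from this[of "rho \<theta>" "rho (rho \<theta>)"] show ?thesis
    unfolding s(2) unfolding s(1) rho_symmetric[OF root]
    by (rule trans) (simp add: algebra_simps power2_eq_square power3_eq_cube)
qed


section \<open>Points with abscissa \<open>\<theta> - 1\<close>\<close>

lemma add_two_torsion:
  fixes x y e :: real
  assumes "y^2 = x^3 - of_int n ^ 2 * x" "e^3 = of_int n ^ 2 * e" and ne: "x \<noteq> e"
  obtains x' y' where "ec_add (- (of_int n ^ 2)) (Affine x y) (Affine e 0) = Affine x' y'"
    "(x' - e) * (x - e) = 3 * e^2 - of_int n ^ 2"
proof -
  define l where "l = (0 - y) / (e - x)"
  have l: "l * (e - x) = 0 - y" using ne by (simp add: l_def)
  have "((l^2 - x - e) - e) * (x - e) = 3 * e^2 - of_int n ^ 2"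
  proof -
    have "(((l^2 - x - e) - e) * (x - e)) * (x - e) = (3 * e^2 - of_int n ^ 2) * (x - e)"
      using l assms by Groebner_Basis.algebra
    then show ?thesis using ne by simp
  qed
  moreover have "ec_add (- (of_int n ^ 2)) (Affine x y) (Affine e 0)
      = Affine (l^2 - x - e) (l * (x - (l^2 - x - e)) - y)"
    using ne by (simp add: ec_add.simps(3) l_def Let_def)
  ultimately show thesis using that by blast
qed

text \<open>The left-hand side has even, the right-hand side odd 2-adic valuation.\<close>

lemma no_odd_square_multiple:
  fixes q :: real and m j :: int
  assumes "q \<in> \<rat>" "odd m" "j \<noteq> 0"
  shows "q^2 * of_int m \<noteq> 2 * (of_int j)^2"
proof
  assume eq: "q^2 * of_int m = 2 * (of_int j)^2"
  with assms(3) have "q \<noteq> 0" by auto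
  then obtain k where k: "val q k" using val_exists assms(1) Rats_subset_K by blast
  obtain i where i: "val (real_of_int j) i" using val_exists[of "real_of_int j"] assms(3) K_closed(11) by auto
  have "val (q * q * of_int m) (k + k + 0)" by (intro val_mult k val_odd assms)
  moreover have "val (2 ^ 1 * (of_int j * of_int j)) (int 1 + (i + i))" by (intro val_mult i val_two_power)
  ultimately have "k + k + 0 = int 1 + (i + i)"
    using eq by (intro val_unique) (auto simp: power2_eq_square)
  then show False by presburger
qed

text \<open>
  If the trace were a point \<open>T = (e, 0)\<close> of order two, then \<open>P + T\<close> would have trace
  \<open>4 T = 0\<close>, so its conjugates would lie on a rational line. Hence the norm of \<open>x(P + T) - e\<close>
  would be a square, and since \<open>(x(P + T) - e) * (x(P) - e) = 3 * e\<^sup>2 - n\<^sup>2\<close>, the norm of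
  \<open>\<theta> - 1 - e\<close> would be a square times \<open>(3 * e\<^sup>2 - n\<^sup>2)\<^sup>3\<close>. For \<open>e = 0\<close> this fails by its sign, for
  \<open>e\<^sup>2 = n\<^sup>2\<close> because \<open>(3 * e\<^sup>2 - n\<^sup>2)\<^sup>3 = 8 * n\<^sup>6\<close> is twice a square and the norm is odd.
\<close>

lemma trace_zero:
  assumes rank: "abelian_rank (E n \<rat>) = 0" and P: "Affine (\<theta> - 1) y \<in> carrier (E n (K t))"
  shows "Tr n t (Affine (\<theta> - 1) y) = Infinity"
proof (rule ccontr)
  let ?P = "Affine (\<theta> - 1) y" and ?G = "E n (K t)"
  define T where "T = Tr n t ?P"
  assume "Tr n t ?P \<noteq> Infinity"
  moreover have TK: "T \<in> carrier ?G" unfolding T_def by (rule Tr_closed[OF P])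
  moreover have cT: "conj_point t T = T" unfolding T_def by (rule conj_point_Tr[OF P])
  ultimately obtain e where e: "e \<in> {0, n, - n}" and T: "T = Affine (of_int e) 0"
    using rank_zero_E_Rats[OF rank conj_point_fixed] unfolding T_def by blast
  define x where "x = \<theta> - 1"
  have xK: "x \<in> K t" using P by (simp add: x_def)
  have xirr: "x \<notin> \<rat>"
  proof
    assume "x \<in> \<rat>"
    then have "x + 1 \<in> \<rat>" by simp
    then show False using root_irrational[OF root] by (simp add: x_def)
  qed
  define c where "c = 3 * e^2 - n^2"
  have e3: "e^3 = n^2 * e" using e by (auto simp: power2_eq_square power3_eq_cube)
  then have "real_of_int (e^3) = real_of_int (n^2 * e)" by (simp only:)
  then have e3': "real_of_int e ^ 3 = of_int n ^ 2 * of_int e" by simp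
  have c: "c = - (n^2) \<and> e = 0 \<or> c = 2 * n^2 \<and> e^2 = n^2"
    using e by (auto simp: c_def)
  then have c0: "c \<noteq> 0" using n by auto
  have y: "y^2 = x^3 - of_int n ^ 2 * x" using P by (simp add: x_def)
  have "x \<noteq> of_int e" using xirr by auto
  then obtain x' y' where Q: "ec_add (- (of_int n ^ 2)) (Affine x y) (Affine (of_int e) 0) = Affine x' y'"
    and x': "(x' - of_int e) * (x - of_int e) = of_int c"
    using add_two_torsion[OF y e3'] unfolding c_def by auto
  then have Q': "?P \<otimes>\<^bsub>?G\<^esub> T = Affine x' y'" by (simp add: T x_def)
  have QK: "Affine x' y' \<in> carrier ?G" unfolding Q'[symmetric] by (rule EK.m_closed[OF P TK])
  then have x'K: "x' \<in> K t" by simp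
  have x'irr: "x' \<notin> \<rat>"
  proof
    assume "x' \<in> \<rat>"
    moreover have "x' - of_int e \<noteq> 0" using x' c0 by auto
    then have "x - of_int e = of_int c / (x' - of_int e)"
      using x' by (simp add: nonzero_eq_divide_eq mult.commute)
    then have "x = of_int e + of_int c / (x' - of_int e)" by simp
    ultimately show False using xirr by (metis Rats_add Rats_diff Rats_divide Rats_of_int)
  qed
  have "T \<otimes>\<^bsub>?G\<^esub> T = Infinity" using ec_add_opposite(1)[of _ "of_int e" "0::real"] by (simp add: T)
  then have "Tr n t (Affine x' y') = Infinity"
    unfolding Q'[symmetric] Tr_mult_fixed[OF P TK cT] T_def[symmetric] by simp
  obtain a b where ab: "a \<in> \<rat>" "b \<in> \<rat>"
    and line: "\<forall>z. z^3 - of_int n ^ 2 * z - (a * z + b)^2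
      = (z - x') * (z - sigma t x') * (z - sigma t (sigma t x'))"
    using trace_zero_line[OF QK x'irr \<open>Tr n t (Affine x' y') = Infinity\<close>] by blast
  have sig: "(sigma t z' - of_int e) * (sigma t z - of_int e) = of_int c"
    if "z \<in> K t" "z' \<in> K t" "(z' - of_int e) * (z - of_int e) = of_int c" for z z'
  proof -
    have "(sigma t z' - of_int e) * (sigma t z - of_int e) = sigma t ((z' - of_int e) * (z - of_int e))"
      using that(1,2) K_closed by (simp add: sigma_mult sigma_diff sigma_Rats)
    then show ?thesis using that(3) by (simp add: sigma_Rats)
  qed
  note x2' = sig[OF xK x'K x']
  note x3' = sig[OF sigma_closed[OF xK] sigma_closed[OF x'K] x2']
  define M where "M = t * ((e + 1) * (e + 2)) - e^2 * (e + 3) + 3"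
  have M: "(of_int e - x) * (of_int e - sigma t x) * (of_int e - sigma t (sigma t x)) = - of_int M"
    using conj_product[of "of_int e"] unfolding x_def M_def
    by (simp add: algebra_simps power2_eq_square power3_eq_cube)
  define q where "q = a * of_int e + b"
  have "q^2 * of_int M = (- (q^2)) * (- of_int M)" by simp
  also have "- (q^2) = of_int e ^ 3 - of_int n ^ 2 * of_int e - (a * of_int e + b)^2"
    using e3' by (simp add: q_def)
  also have "\<dots> * (- of_int M) = ((of_int e - x') * (of_int e - sigma t x') * (of_int e - sigma t (sigma t x')))
      * ((of_int e - x) * (of_int e - sigma t x) * (of_int e - sigma t (sigma t x)))"
    unfolding line[rule_format] M ..
  also have "\<dots> = ((x' - of_int e) * (x - of_int e)) * ((sigma t x' - of_int e) * (sigma t x - of_int e))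
      * ((sigma t (sigma t x') - of_int e) * (sigma t (sigma t x) - of_int e))"
    by Groebner_Basis.algebra
  also have "\<dots> = of_int c ^ 3"
    unfolding x' x2' x3' by (simp add: power3_eq_cube)
  finally have qM: "q^2 * of_int M = of_int c ^ 3" .
  have qQ: "q \<in> \<rat>" using ab by (simp add: q_def)
  from c show False
  proof
    assume *: "c = - (n^2) \<and> e = 0"
    then have "M > 0" using t by (simp add: M_def)
    then have "q^2 * of_int M \<ge> 0" by simp
    moreover have "real_of_int c < 0" using * n by simp
    then have "real_of_int c ^ 3 < 0" by (simp add: power_less_zero_eq)
    ultimately show False using qM by simp
  next
    assume *: "c = 2 * n^2 \<and> e^2 = n^2"
    have "real_of_int c ^ 3 = 2 * (of_int (2 * n^3))^2" using * by (simp add: power_mult_distrib)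
    \<comment> \<open>Both \<open>(e + 1) * (e + 2)\<close> and \<open>e\<^sup>2 * (e + 3)\<close> are even.\<close>
    moreover have "odd M" unfolding M_def by simp
    ultimately show False using no_odd_square_multiple[OF qQ, of M "2 * n^3"] qM n by simp
  qed
qed

lemma parameter_from_trace_zero:
  assumes P: "Affine (\<theta> - 1) y \<in> carrier (E n (K t))" and tr: "Tr n t (Affine (\<theta> - 1) y) = Infinity"
  shows "\<exists>v::int. v > 0 \<and> v^2 = 2 * n^2 - 9 \<and> (t = (n + v)^2 + 3 \<or> t = (n - v)^2 + 3)"
proof -
  have irr: "\<theta> - 1 \<notin> \<rat>"
  proof
    assume "\<theta> - 1 \<in> \<rat>"
    then have "\<theta> - 1 + 1 \<in> \<rat>" by (rule Rats_add) simp
    then show False using root_irrational[OF root] by simp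
  qed
  obtain a b where "\<forall>z. z^3 - of_int n ^ 2 * z - (a * z + b)^2
      = (z - (\<theta> - 1)) * (z - sigma t (\<theta> - 1)) * (z - sigma t (sigma t (\<theta> - 1)))"
    using trace_zero_line[OF P irr tr] by blast
  note line = this[rule_format, unfolded conj_product]
  have "(a * 1 + b)^2 = a^2 + b^2 + 2 * a * b" "(a * (- 1) + b)^2 = a^2 + b^2 - 2 * a * b"
    by (simp_all add: power2_eq_square algebra_simps)
  with line[of 0] line[of 1] line[of "- 1"]
  have coeffs: "b^2 = 2 * of_int t + 3" "a^2 = of_int t - 3" "2 * a * b = 3 * of_int t - of_int n ^ 2"
    by simp_all
  have "(2 * a * b)^2 = 4 * a^2 * b^2" by (simp add: power_mult_distrib)
  then have "(of_int t - 3 * of_int n ^ 2 + 6)^2 = (2 * of_int n)^2 * (2 * of_int n ^ 2 - 9 :: real)"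
    unfolding coeffs by (simp add: algebra_simps power2_eq_square)
  then have "real_of_int ((t - 3 * n^2 + 6)^2) = real_of_int ((2 * n)^2 * (2 * n^2 - 9))" by simp
  then have sq: "(t - 3 * n^2 + 6)^2 = (2 * n)^2 * (2 * n^2 - 9)" by (simp only: of_int_eq_iff)
  \<comment> \<open>So \<open>2 n\<^sup>2 - 9\<close> is the square of a rational number, hence of an integer.\<close>
  then have "(2 * n)^2 dvd (t - 3 * n^2 + 6)^2" by simp
  then have "2 * n dvd t - 3 * n^2 + 6" by (subst (asm) pow_divides_pow_iff) auto
  then obtain w where w: "t - 3 * n^2 + 6 = 2 * n * w" by (auto elim: dvdE)
  have "(2 * n)^2 * w^2 = (2 * n)^2 * (2 * n^2 - 9)" using sq unfolding w by (simp add: power_mult_distrib)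
  then have w2: "w^2 = 2 * n^2 - 9" using n by simp
  have "w \<noteq> 0"
  proof
    assume "w = 0"
    then have "2 * n^2 = 9" using w2 by simp
    then show False by presburger
  qed
  have tw: "t = (n + w)^2 + 3" using w w2 by (simp add: power2_eq_square algebra_simps)
  show ?thesis
  proof (cases "w > 0")
    case True
    then show ?thesis using w2 tw by blast
  next
    case False
    then show ?thesis using w2 tw \<open>w \<noteq> 0\<close> by (intro exI[of _ "- w"]) auto
  qed
qed

text \<open>The sign of \<open>w\<close> is free, which covers both families of parameters.\<close>

lemma ordinates:
  fixes w :: int
  assumes w: "w^2 = 2 * n^2 - 9" and tw: "t = (n + w)^2 + 3"
  shows "{y. Affine (\<theta> - 1) y \<in> carrier (E n (K t))}
    = {of_int (n + w) * \<theta> + of_int n, - (of_int (n + w) * \<theta> + of_int n)}"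
proof -
  define y0 where "y0 = of_int (n + w) * \<theta> + of_int n"
  have w': "real_of_int w ^ 2 = 2 * of_int n ^ 2 - 9" using arg_cong[OF w, of real_of_int] by simp
  have tw': "real_of_int t = (of_int n + of_int w)^2 + 3" using arg_cong[OF tw, of real_of_int] by simp
  have y0: "y0^2 = (\<theta> - 1)^3 - of_int n ^ 2 * (\<theta> - 1)"
    using root[unfolded poly_g] w' tw' unfolding y0_def of_int_add by Groebner_Basis.algebra
  have K: "y0 \<in> K t" "- y0 \<in> K t" "\<theta> - 1 \<in> K t" unfolding y0_def by (intro K_closed theta_in_K)+
  have "Affine (\<theta> - 1) y \<in> carrier (E n (K t)) \<longleftrightarrow> y \<in> {y0, - y0}" for y
  proof -
    have "Affine (\<theta> - 1) y \<in> carrier (E n (K t)) \<longleftrightarrow> y \<in> K t \<and> y^2 = y0^2"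
      unfolding y0 using K by simp
    also have "\<dots> \<longleftrightarrow> y \<in> {y0, - y0}" using K by (auto simp: power2_eq_iff)
    finally show ?thesis .
  qed
  then show ?thesis unfolding y0_def by blast
qed

lemma infinite_order_and_rank:
  assumes P: "Affine (\<theta> - 1) y \<in> carrier (E n (K t))" (is "?P \<in> _")
    and tr: "Tr n t (Affine (\<theta> - 1) y) = Infinity"
  shows "infinite_order (E n (K t)) ?P"
    and "abelian_rank (subgroup_generated (E n (K t)) {?P, conj_point t ?P, conj_point t (conj_point t ?P)}) = 2"
proof -
  have "y \<noteq> 0"
  proof
    assume "y = 0"
    then have "(\<theta> - 1)^3 - of_int n ^ 2 * (\<theta> - 1) = 0" using P by simp
    then have "(\<theta> - 1) * (\<theta> - 1 - of_int n) * (\<theta> - 1 + of_int n) = 0" by Groebner_Basis.algebra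
    then have "\<theta> = of_int 1 \<or> \<theta> = of_int (1 + n) \<or> \<theta> = of_int (1 - n)" by auto
    then show False using root_irrational[OF root] by (metis Rats_of_int)
  qed
  then show inf: "infinite_order (E n (K t)) ?P" by (rule infinite_order_E[OF n P])
  show "abelian_rank (subgroup_generated (E n (K t)) {?P, conj_point t ?P, conj_point t (conj_point t ?P)}) = 2"
    by (rule EK.trace_zero_rank_two[OF conj_point_hom P inf]) (use tr in \<open>simp add: Tr_def\<close>)
qed

end

end

theorem theorem1:
  fixes t n :: int
  assumes "t \<ge> - 1" and "n > 0"
    and "abelian_rank (E n \<rat>) = 0"
  shows "((\<exists>y. Affine (theta t - 1) y \<in> carrier (E n (K t))) \<longleftrightarrow>
          (\<exists>v::int. v > 0 \<and> v^2 = 2 * n^2 - 9 \<and> (t = (n + v)^2 + 3 \<or> t = (n - v)^2 + 3)))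
    \<and> (\<forall>v::int. v > 0 \<and> v^2 = 2 * n^2 - 9 \<and> t = (n + v)^2 + 3 \<longrightarrow>
          {y. Affine (theta t - 1) y \<in> carrier (E n (K t))} =
          {of_int (n + v) * theta t + of_int n, - (of_int (n + v) * theta t + of_int n)})
    \<and> (\<forall>v::int. v > 0 \<and> v^2 = 2 * n^2 - 9 \<and> t = (n - v)^2 + 3 \<longrightarrow>
          {y. Affine (theta t - 1) y \<in> carrier (E n (K t))} =
          {of_int (n - v) * theta t + of_int n, - (of_int (n - v) * theta t + of_int n)})
    \<and> (\<forall>y. \<forall>P. P = Affine (theta t - 1) y \<and> P \<in> carrier (E n (K t)) \<longrightarrow>
          Tr n t P = \<one>\<^bsub>E n (K t)\<^esub> \<and>
          infinite_order (E n (K t)) P \<and>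
          abelian_rank (subgroup_generated (E n (K t))
            {P, conj_point t P, conj_point t (conj_point t P)}) = 2)"
proof -
  interpret simplest_cubic t by unfold_locales (rule assms)
  note n = assms(2) and rank = assms(3)
  have tr: "Tr n t (Affine (theta t - 1) y) = Infinity" if "Affine (theta t - 1) y \<in> carrier (E n (K t))" for y
    using trace_zero[OF n rank that] .
  have ord: "{y. Affine (theta t - 1) y \<in> carrier (E n (K t))}
      = {of_int (n + w) * theta t + of_int n, - (of_int (n + w) * theta t + of_int n)}"
    if "w^2 = 2 * n^2 - 9" "t = (n + w)^2 + 3" for w
    using ordinates[OF n that] .
  have ord': "{y. Affine (theta t - 1) y \<in> carrier (E n (K t))}
      = {of_int (n - w) * theta t + of_int n, - (of_int (n - w) * theta t + of_int n)}"
    if "w^2 = 2 * n^2 - 9" "t = (n - w)^2 + 3" for w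
    using ord[of "- w"] that by simp
  show ?thesis
  proof (intro conjI allI impI)
    show "(\<exists>y. Affine (theta t - 1) y \<in> carrier (E n (K t))) \<longleftrightarrow>
          (\<exists>v::int. v > 0 \<and> v^2 = 2 * n^2 - 9 \<and> (t = (n + v)^2 + 3 \<or> t = (n - v)^2 + 3))"
    proof
      assume "\<exists>y. Affine (theta t - 1) y \<in> carrier (E n (K t))"
      then show "\<exists>v::int. v > 0 \<and> v^2 = 2 * n^2 - 9 \<and> (t = (n + v)^2 + 3 \<or> t = (n - v)^2 + 3)"
        using parameter_from_trace_zero[OF n _ tr] by blast
    next
      assume "\<exists>v::int. v > 0 \<and> v^2 = 2 * n^2 - 9 \<and> (t = (n + v)^2 + 3 \<or> t = (n - v)^2 + 3)"
      then show "\<exists>y. Affine (theta t - 1) y \<in> carrier (E n (K t))"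
        using ord ord' by blast
    qed
  qed (use ord ord' tr infinite_order_and_rank[OF n _ tr] in \<open>simp_all del: E_simps(1,3,4) of_int_add of_int_diff\<close>)
qed

end
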